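(* Let $R$ be a rational function without poles in $\overline{\mathbb{D}}$, of degree $N=N_1+N_2$, written as $$R(z)=P(z)+\sum_{l=1}^{r}\sum_{j=1}^{k_l}\frac{\alpha_{l,j}}{(z-\eta_l)^j},$$ where $P$ is a polynomial of degree $N_1$, $\alpha_{l,j}\in\mathbb{C}$, the points $\eta_1,\dots,\eta_r\in\mathbb{C}\setminus\overline{\mathbb{D}}$ are the distinct poles of $R$, of multiplicities $k_1,\dots,k_r$, and $N_2=\sum_{l=1}^r k_l$. Let $\varphi\in H^\infty$ and $$\Phi(z)=R\Big(\frac1z\Big)+\varphi(z).$$ If the Toeplitz operator $T_\Phi$ is hypercyclic on $H^2$, then $\Phi$ is $N$-valent in $\mathbb{D}$, i.e. for every $w\in\mathbb{C}$ the equation $\Phi(z)=w$ has at most $N$ solutions in $\mathbb{D}$ counting multiplicities.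
   Context: $\mathbb{D}$ is the open unit disc and $\mathbb{T}$ the unit circle. $H^2$ is the Hardy space of functions analytic in $\mathbb{D}$ with square summable Taylor coefficients (identified with a closed subspace of $L^2(\mathbb{T})$ via boundary values), and $H^\infty$ is the space of bounded analytic functions in $\mathbb{D}$. For $\psi\in L^\infty(\mathbb{T})$ the Toeplitz operator $T_\psi:H^2\to H^2$ is $T_\psi f=P_+(\psi f)$, where $P_+$ is the orthogonal projection from $L^2(\mathbb{T})$ onto $H^2$; $T_\Phi$ is the Toeplitz operator whose symbol is the boundary function of $\Phi$ on $\mathbb{T}$. A continuous linear operator $T$ on a separable Banach space $X$ is hypercyclic if there is $x\in X$ such that $\{T^n x:n=0,1,2,\dots\}$ is dense in $X$. The cases $N_1=0$ ($P$ constant) and $N_2=0$ ($r=0$, $R=P$) are allowed. The function $\Phi$ is analytic in $\mathbb{D}$ except for poles: a pole of order $N_1$ at $0$ (if $N_1\ge1$) and poles of multiplicity $k_l$ at $1/\eta_l$. Solutions of $\Phi(z)=w$ are sought among points of $\mathbb{D}$ that are not poles. *)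

theory Defs
  imports "HOL-Complex_Analysis.Complex_Analysis"
begin

section \<open>The Hardy spaces\<close>

definition taylor_coeff :: "(complex \<Rightarrow> complex) \<Rightarrow> nat \<Rightarrow> complex" where
  "taylor_coeff f n = (deriv ^^ n) f 0 / fact n"

text \<open>
  Elements of \<open>H\<^sup>2\<close> are functions on the disc; as HOL functions are total, the value
  outside the disc is fixed to be \<open>0\<close>, so that equality of functions is equality in \<open>H\<^sup>2\<close>.
\<close>

definition H2 :: "(complex \<Rightarrow> complex) set" where
  "H2 = {f. f holomorphic_on ball 0 1 \<and> (\<forall>z. z \<notin> ball 0 1 \<longrightarrow> f z = 0) \<and>
            (\<lambda>n. (cmod (taylor_coeff f n))\<^sup>2) summable_on UNIV}"

text \<open>The distance induced by the norm \<open>\<parallel>f\<parallel>\<^sup>2 = \<Sum>\<^sub>n \<bar>a\<^sub>n\<bar>\<^sup>2\<close>.\<close>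

definition H2_dist :: "(complex \<Rightarrow> complex) \<Rightarrow> (complex \<Rightarrow> complex) \<Rightarrow> real" where
  "H2_dist f g = sqrt (\<Sum>\<^sub>\<infinity>n. (cmod (taylor_coeff f n - taylor_coeff g n))\<^sup>2)"

definition H_inf :: "(complex \<Rightarrow> complex) set" where
  "H_inf = {f. f holomorphic_on ball 0 1 \<and> bounded (f ` ball 0 1)}"

lemma square_summable_diff:
  fixes a b :: "nat \<Rightarrow> complex"
  assumes "(\<lambda>n. (cmod (a n))\<^sup>2) summable_on UNIV" "(\<lambda>n. (cmod (b n))\<^sup>2) summable_on UNIV"
  shows "(\<lambda>n. (cmod (a n - b n))\<^sup>2) summable_on UNIV"
proof (rule summable_on_comparison_test)
  show "(\<lambda>n. 2 * (cmod (a n))\<^sup>2 + 2 * (cmod (b n))\<^sup>2) summable_on UNIV"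
    by (intro summable_on_add summable_on_cmult_right assms)
  fix n
  have "(cmod (a n - b n))\<^sup>2 \<le> (cmod (a n) + cmod (b n))\<^sup>2"
    by (intro power_mono norm_triangle_ineq4) auto
  also have "\<dots> \<le> 2 * (cmod (a n))\<^sup>2 + 2 * (cmod (b n))\<^sup>2"
    using sum_squares_bound[of "cmod (a n)" "cmod (b n)"] by (simp add: power2_sum)
  finally show "(cmod (a n - b n))\<^sup>2 \<le> 2 * (cmod (a n))\<^sup>2 + 2 * (cmod (b n))\<^sup>2" .
qed auto

lemma minkowski_infsum:
  fixes a b c :: "nat \<Rightarrow> complex"
  assumes "(\<lambda>n. (cmod (a n - b n))\<^sup>2) summable_on UNIV"
    and "(\<lambda>n. (cmod (b n - c n))\<^sup>2) summable_on UNIV"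
    and "(\<lambda>n. (cmod (a n - c n))\<^sup>2) summable_on UNIV"
  shows "sqrt (\<Sum>\<^sub>\<infinity>n. (cmod (a n - c n))\<^sup>2)
    \<le> sqrt (\<Sum>\<^sub>\<infinity>n. (cmod (a n - b n))\<^sup>2) + sqrt (\<Sum>\<^sub>\<infinity>n. (cmod (b n - c n))\<^sup>2)" (is "_ \<le> ?B")
proof -
  have B0: "0 \<le> ?B" by (intro add_nonneg_nonneg) (auto intro: infsum_nonneg)
  have "(\<Sum>\<^sub>\<infinity>n. (cmod (a n - c n))\<^sup>2) \<le> ?B\<^sup>2"
  proof (rule infsum_le_finite_sums[OF assms(3)])
    fix F :: "nat set" assume F: "finite F"
    have "L2_set (\<lambda>n. cmod (a n - c n)) F
        \<le> L2_set (\<lambda>n. cmod (a n - b n) + cmod (b n - c n)) F"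
      by (rule L2_set_mono)
        (use norm_triangle_ineq[of "a n - b n" "b n - c n" for n] in auto)
    also have "\<dots> \<le> L2_set (\<lambda>n. cmod (a n - b n)) F + L2_set (\<lambda>n. cmod (b n - c n)) F"
      by (rule L2_set_triangle_ineq)
    also have "\<dots> \<le> ?B"
      unfolding L2_set_def
      by (intro add_mono real_sqrt_le_mono finite_sum_le_infsum assms F) auto
    finally have "sqrt (\<Sum>n\<in>F. (cmod (a n - c n))\<^sup>2) \<le> ?B" by (simp add: L2_set_def)
    then show "(\<Sum>n\<in>F. (cmod (a n - c n))\<^sup>2) \<le> ?B\<^sup>2" by (rule sqrt_le_D)
  qed
  then show ?thesis using B0 by (rule real_le_lsqrt[rotated])
qed

interpretation H2: Metric_space H2 H2_dist
proof
  fix f g h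
  show "0 \<le> H2_dist f g" by (auto simp: H2_dist_def intro: infsum_nonneg)
  show "H2_dist f g = H2_dist g f" by (simp add: H2_dist_def norm_minus_commute)
  assume fg: "f \<in> H2" "g \<in> H2"
  have sm: "(\<lambda>n. (cmod (taylor_coeff u n - taylor_coeff v n))\<^sup>2) summable_on UNIV"
    if "u \<in> H2" "v \<in> H2" for u v
    using that by (intro square_summable_diff) (auto simp: H2_def)
  show "H2_dist f g = 0 \<longleftrightarrow> f = g"
  proof
    assume "H2_dist f g = 0"
    then have z: "(\<Sum>\<^sub>\<infinity>n. (cmod (taylor_coeff f n - taylor_coeff g n))\<^sup>2) = 0"
      by (simp add: H2_dist_def)
    have "(cmod (taylor_coeff f n - taylor_coeff g n))\<^sup>2 = 0" for n
      by (rule nonneg_infsum_le_0D[OF eq_refl[OF z] sm[OF fg]]) auto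
    then have d: "(deriv ^^ n) f 0 = (deriv ^^ n) g 0" for n
      by (simp add: taylor_coeff_def)
    show "f = g"
    proof
      fix z show "f z = g z"
      proof (cases "z \<in> ball 0 1")
        case True
        then show ?thesis using fg d
          by (intro holomorphic_fun_eq_on_ball[of f 0 1 g]) (auto simp: H2_def)
      next
        case False
        then show ?thesis using fg unfolding H2_def by (auto simp del: mem_ball)
      qed
    qed
  qed (simp add: H2_dist_def)
  assume h: "h \<in> H2"
  show "H2_dist f h \<le> H2_dist f g + H2_dist g h"
    unfolding H2_dist_def using fg h by (intro minkowski_infsum sm)
qed

section \<open>The space \<open>L\<^sup>2\<close> of the circle and boundary functions\<close>

text \<open>Normalised arc length of the unit circle, as a measure on \<open>\<complex>\<close>.\<close>

definition arc_measure :: "complex measure" where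
  "arc_measure = distr (uniform_measure lborel {0..<2 * pi}) borel cis"

text \<open>Representatives of the classes in \<open>L\<^sup>2\<close> and the inner product of \<open>L\<^sup>2\<close>.\<close>

definition L2_circle :: "(complex \<Rightarrow> complex) set" where
  "L2_circle = {F. F \<in> borel_measurable borel \<and> integrable arc_measure (\<lambda>\<zeta>. (cmod (F \<zeta>))\<^sup>2)}"

definition inner_L2 :: "(complex \<Rightarrow> complex) \<Rightarrow> (complex \<Rightarrow> complex) \<Rightarrow> complex" where
  "inner_L2 F G = (LINT \<zeta>|arc_measure. F \<zeta> * cnj (G \<zeta>))"

text \<open>
  \<open>F\<close> is (a representative of) the boundary function of \<open>f\<close>: the radial limit of \<open>f\<close> exists
  and equals \<open>F\<close> almost everywhere on the circle.
\<close>

definition boundary_function :: "(complex \<Rightarrow> complex) \<Rightarrow> (complex \<Rightarrow> complex) \<Rightarrow> bool" where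
  "boundary_function f F \<longleftrightarrow> F \<in> borel_measurable borel \<and>
     (AE \<zeta> in arc_measure. ((\<lambda>t::real. f (of_real t * \<zeta>)) \<longlongrightarrow> F \<zeta>) (at_left 1))"

text \<open>\<open>H\<^sup>2\<close> as a subspace of \<open>L\<^sup>2\<close>, and the orthogonal projection \<open>P\<^sub>+\<close> onto it as a relation.\<close>

definition H2_circle :: "(complex \<Rightarrow> complex) set" where
  "H2_circle = {F \<in> L2_circle. \<exists>f\<in>H2. boundary_function f F}"

definition P_plus :: "(complex \<Rightarrow> complex) \<Rightarrow> (complex \<Rightarrow> complex) \<Rightarrow> bool" where
  "P_plus U G \<longleftrightarrow> U \<in> L2_circle \<and> G \<in> H2_circle \<and>
     (\<forall>H\<in>H2_circle. inner_L2 (\<lambda>\<zeta>. U \<zeta> - G \<zeta>) H = 0)"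

section \<open>Toeplitz operators and hypercyclicity\<close>

text \<open>
  \<open>T\<close> is the Toeplitz operator \<open>f \<mapsto> P\<^sub>+ (\<psi> f)\<close>, for \<open>\<psi> \<in> L\<^sup>\<infinity>\<close>.  The functions \<open>f\<close> and \<open>T f\<close>
  live on the disc, \<open>F\<close> and \<open>G\<close> are their boundary functions.  This determines \<open>T\<close> on \<open>H2\<close>;
  the values of \<open>T\<close> outside \<open>H2\<close> are irrelevant.
\<close>

definition toeplitz_operator ::
    "(complex \<Rightarrow> complex) \<Rightarrow> ((complex \<Rightarrow> complex) \<Rightarrow> (complex \<Rightarrow> complex)) \<Rightarrow> bool" where
  "toeplitz_operator \<psi> T \<longleftrightarrow>
     (\<forall>f\<in>H2. T f \<in> H2 \<and>
        (\<exists>F G. boundary_function f F \<and> boundary_function (T f) G \<and> P_plus (\<lambda>\<zeta>. \<psi> \<zeta> * F \<zeta>) G))"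

definition linear_on_H2 :: "((complex \<Rightarrow> complex) \<Rightarrow> (complex \<Rightarrow> complex)) \<Rightarrow> bool" where
  "linear_on_H2 T \<longleftrightarrow>
     (\<forall>f\<in>H2. \<forall>g\<in>H2. T (\<lambda>z. f z + g z) = (\<lambda>z. T f z + T g z)) \<and>
     (\<forall>c. \<forall>f\<in>H2. T (\<lambda>z. c * f z) = (\<lambda>z. c * T f z))"

definition hypercyclic_on_H2 :: "((complex \<Rightarrow> complex) \<Rightarrow> (complex \<Rightarrow> complex)) \<Rightarrow> bool" where
  "hypercyclic_on_H2 T \<longleftrightarrow>
     linear_on_H2 T \<and> continuous_map H2.mtopology H2.mtopology T \<and>
     (\<exists>x\<in>H2. H2.mtopology closure_of (range (\<lambda>n. (T ^^ n) x)) = H2)"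

section \<open>Symbols and valence\<close>

definition rational_pf ::
    "complex poly \<Rightarrow> nat \<Rightarrow> (nat \<Rightarrow> nat) \<Rightarrow> (nat \<Rightarrow> complex) \<Rightarrow> (nat \<Rightarrow> nat \<Rightarrow> complex) \<Rightarrow>
     complex \<Rightarrow> complex" where
  "rational_pf P r k \<eta> \<alpha> z = poly P z + (\<Sum>l=1..r. \<Sum>j=1..k l. \<alpha> l j / (z - \<eta> l) ^ j)"

text \<open>
  The function \<open>\<Phi>(z) = R(1/z) + \<phi>(z)\<close>.  If \<open>P\<close> is constant, \<open>z = 0\<close> is not a pole of \<open>\<Phi>\<close> and
  \<open>R(1/z)\<close> has the value \<open>R(\<infinity>) = P\<close> there, whereas in HOL \<open>1/0 = 0\<close>.  If \<open>P\<close> is not constant,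
  then \<open>0\<close> is a pole and the value at \<open>0\<close> is irrelevant.
\<close>

definition symbol_fun ::
    "complex poly \<Rightarrow> nat \<Rightarrow> (nat \<Rightarrow> nat) \<Rightarrow> (nat \<Rightarrow> complex) \<Rightarrow> (nat \<Rightarrow> nat \<Rightarrow> complex) \<Rightarrow>
     (complex \<Rightarrow> complex) \<Rightarrow> complex \<Rightarrow> complex" where
  "symbol_fun P r k \<eta> \<alpha> \<phi> z =
     (if z = 0 then coeff P 0 else rational_pf P r k \<eta> \<alpha> (1 / z)) + \<phi> z"

text \<open>
  At a solution \<open>z\<close> of \<open>f z = w\<close> that is not a pole and near which \<open>f\<close> is not constant,
  \<open>zorder (\<lambda>z. f z - w) z\<close> is the multiplicity of the solution; if \<open>f\<close> is constant near some
  solution, the set of solutions is infinite.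
\<close>

definition valent_in_disc :: "nat \<Rightarrow> (complex \<Rightarrow> complex) \<Rightarrow> bool" where
  "valent_in_disc N f \<longleftrightarrow>
     (\<forall>w. let S = {z \<in> ball 0 1. \<not> is_pole f z \<and> f z = w}
          in finite S \<and> (\<Sum>z\<in>S. zorder (\<lambda>z. f z - w) z) \<le> int N)"

end

theory Submission
  imports Defs
begin

text \<open>
Hypercyclicity rules out eigenfunctionals: if a nonzero continuous linear functional \<open>L\<close> satisfies
\<open>L (T f) = w * L f\<close>, then \<open>L\<close> maps the orbit of \<open>x\<close> to the numbers \<open>w ^ n * L x\<close>, which are never
dense in the plane (\<open>eigenfunctional_not_hypercyclic\<close>).  The valence bound is obtained by exhibiting
such a functional whenever \<open>\<Phi> = w\<close> has too many solutions.

Multiplying \<open>\<Phi>\<close> by the polynomial \<open>B(z) = z ^ N\<^sub>1 * (\<Prod>l. (1 - \<eta>\<^sub>l z) ^ k\<^sub>l)\<close>, of degree \<open>N\<close> with all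
roots in the disc, clears the poles, so that \<open>g = B (\<Phi> - w)\<close> is a bounded analytic function.
Suppose that \<open>g = b h\<close> with \<open>h\<close> bounded analytic and \<open>b\<close> a polynomial having all its roots in the
disc and degree \<open>d + N\<close> with \<open>d > 0\<close>.  On the circle the function \<open>\<zeta> ^ d * B(\<zeta>) / b(\<zeta>)\<close> is the
conjugate of \<open>U = B\<^sup>* / b\<^sup>*\<close>, where the star denotes the reflection of a polynomial in the circle; the
roots of \<open>b\<^sup>*\<close> lie outside the closed disc, so \<open>U\<close> belongs to \<open>H\<^sup>2\<close>.  For every \<open>f\<close> in \<open>H\<^sup>2\<close> one gets
\<open>\<langle>(T - w) f, U\<rangle> = \<integral> (\<psi> - w) f cnj U = \<integral> \<zeta> ^ d * h f = 0\<close>,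
since the last integrand is analytic and vanishes at \<open>0\<close>.  Hence pairing with \<open>U\<close> is an
eigenfunctional, which contradicts hypercyclicity (\<open>toeplitz_hypercyclic_zero_bound\<close>).

So every such \<open>b\<close> has degree at most \<open>N\<close>.  For a \<open>b\<close> of maximal degree the cofactor \<open>h\<close> has no zero,
because a zero could be moved into \<open>b\<close>.  The solutions of \<open>\<Phi> = w\<close> are then roots of \<open>b\<close>, with
multiplicity the order of the root, and their number is at most the degree of \<open>b\<close>.

The analysis behind the pairing consists of two facts about radial limits on the circle: the
\<open>L\<^sup>2\<close> norm of a boundary function is at most the \<open>H\<^sup>2\<close> norm (Parseval for polynomials and Fatou's
lemma), and a bounded analytic function has the mean value of its boundary function at \<open>0\<close>.
\<close>

section \<open>Normalised arc length\<close>

lemma sets_arc_measure [simp, measurable_cong]: "sets arc_measure = sets borel"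
  by (simp add: arc_measure_def)

lemma space_arc_measure [simp]: "space arc_measure = UNIV"
  by (simp add: arc_measure_def)

lemma cis_borel_measurable [measurable]: "cis \<in> borel_measurable borel"
  by (intro borel_measurable_continuous_onI continuous_intros)

lemma borel_measurable_cnj [measurable (raw)]:
  "f \<in> borel_measurable M \<Longrightarrow> (\<lambda>x. cnj (f x)) \<in> borel_measurable M"
  by (rule measurable_compose[where g = cnj])
     (auto intro!: borel_measurable_continuous_onI continuous_intros)

lemma emeasure_arc_measure_UNIV: "emeasure arc_measure UNIV = 1"
proof -
  have "cis \<in> measurable (uniform_measure lborel {0..<2*pi}) borel" by simp
  then have "emeasure arc_measure UNIV = emeasure (uniform_measure lborel {0..<2*pi}) (cis -` UNIV \<inter> space (uniform_measure lborel {0..<2*pi}))"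
    unfolding arc_measure_def by (rule emeasure_distr) auto
  also have "\<dots> = 1" by (simp add: ennreal_divide_self[of "ennreal (2*pi)"])
  finally show ?thesis .
qed

interpretation arc: finite_measure arc_measure
  by standard (simp add: emeasure_arc_measure_UNIV)

lemma AE_arc_norm: "AE \<zeta> in arc_measure. cmod \<zeta> = 1"
  unfolding arc_measure_def by (subst AE_distr_iff) auto

lemma integral_arc_measure:
  fixes f :: "complex \<Rightarrow> complex"
  assumes [measurable]: "f \<in> borel_measurable borel"
  shows "(LINT \<zeta>|arc_measure. f \<zeta>)
       = (LINT \<theta>|lborel. indicator {0..2*pi} \<theta> *\<^sub>R f (cis \<theta>)) / of_real (2*pi)"
proof -
  have "(LINT \<zeta>|arc_measure. f \<zeta>) = (LINT \<theta>|uniform_measure lborel {0..<2*pi}. f (cis \<theta>))"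
    unfolding arc_measure_def by (subst integral_distr) auto
  also have "uniform_measure lborel {0..<2*pi}
      = density lborel (\<lambda>\<theta>. ennreal (indicator {0..<2*pi} \<theta> / (2*pi)))"
    unfolding uniform_measure_def
    by (intro density_cong) (auto simp: indicator_def divide_ennreal simp flip: ennreal_1)
  also have "(LINT \<theta>|\<dots>. f (cis \<theta>)) = (LINT \<theta>|lborel. (indicator {0..<2*pi} \<theta> / (2*pi)) *\<^sub>R f (cis \<theta>))"
    by (subst integral_density) auto
  also have "\<dots> = (LINT \<theta>|lborel. (indicator {0..2*pi} \<theta> *\<^sub>R f (cis \<theta>)) / of_real (2*pi))"
  proof (rule integral_cong_AE)
    show "AE x in lborel. (indicat_real {0..<2 * pi} x / (2 * pi)) *\<^sub>R f (cis x)
        = indicat_real {0..2 * pi} x *\<^sub>R f (cis x) / complex_of_real (2 * pi)"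
      using AE_lborel_singleton[of "2*pi"]
      by eventually_elim (auto simp: indicator_def scaleR_conv_of_real)
  qed auto
  finally show ?thesis by simp
qed

text \<open>
For \<open>k \<noteq> 0\<close> the integrand has the \<open>2 * pi\<close>-periodic primitive \<open>cis (k * \<theta>) / (\<i> * k)\<close>.
\<close>

lemma integral_arc_cis:
  fixes k :: int
  shows "(LINT \<theta>|lborel. indicator {0..2*pi} \<theta> *\<^sub>R cis (of_int k * \<theta>)) = (if k = 0 then of_real (2*pi) else 0)"
proof (cases "k = 0")
  case False
  have "(LINT \<theta>|lborel. indicator {0..2*pi} \<theta> *\<^sub>R cis (of_int k * \<theta>))
      = cis (of_int k * (2*pi)) / (\<i> * of_int k) - cis (of_int k * 0) / (\<i> * of_int k)"
  proof (rule integral_FTC_atLeastAtMost)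
    fix x :: real
    show "((\<lambda>x. cis (of_int k * x) / (\<i> * of_int k)) has_vector_derivative cis (of_int k * x)) (at x within {0..2*pi})"
    proof -
      have "((\<lambda>z. exp (\<i> * (of_int k * z)) / (\<i> * of_int k)) has_field_derivative exp (\<i> * (of_int k * of_real x)))
              (at (of_real x))"
        using False by (auto intro!: derivative_eq_intros simp: field_simps)
      from has_vector_derivative_real_field[OF this] show ?thesis
        by (simp add: cis_conv_exp)
    qed
  qed (auto intro!: continuous_intros)
  also have "cis (of_int k * (2*pi)) = 1"
    using cis_multiple_2pi[of "of_int k"] by (simp add: mult_ac)
  finally show ?thesis using False by simp
qed (simp add: scaleR_conv_of_real)

lemma integral_arc_power_cnj_power:
  "(LINT \<zeta>|arc_measure. \<zeta> ^ n * cnj (\<zeta> ^ m)) = (if n = m then 1 else 0)"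
proof -
  have "real n * \<theta> + real m * (- \<theta>) = of_int (int n - int m) * \<theta>" for \<theta>
    by (simp add: algebra_simps)
  then have "cis \<theta> ^ n * cnj (cis \<theta> ^ m) = cis (of_int (int n - int m) * \<theta>)" for \<theta>
    unfolding complex_cnj_power cis_cnj by (simp only: Complex.DeMoivre cis_mult)
  then have "(LINT \<zeta>|arc_measure. \<zeta> ^ n * cnj (\<zeta> ^ m))
     = (LINT \<theta>|lborel. indicator {0..2*pi} \<theta> *\<^sub>R cis (of_int (int n - int m) * \<theta>)) / of_real (2*pi)"
    by (subst integral_arc_measure)
      (intro borel_measurable_continuous_onI continuous_intros, simp del: complex_cnj_power of_int_diff)
  then show ?thesis unfolding integral_arc_cis by simp
qed

lemma integrable_arc_bounded:
  fixes f :: "complex \<Rightarrow> complex"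
  assumes "f \<in> borel_measurable borel" "\<And>\<zeta>. cmod \<zeta> = 1 \<Longrightarrow> cmod (f \<zeta>) \<le> K"
  shows "integrable arc_measure f"
proof (rule arc.integrable_const_bound)
  show "AE x in arc_measure. cmod (f x) \<le> K"
    using AE_arc_norm by eventually_elim (rule assms(2))
qed (use assms in auto)

lemma integrable_arc_continuous:
  fixes f :: "complex \<Rightarrow> complex"
  assumes "continuous_on UNIV f"
  shows "integrable arc_measure f"
proof -
  have "compact (f ` sphere 0 1)"
    using assms by (intro compact_continuous_image) (auto intro: continuous_on_subset)
  then obtain K where "\<And>x. x \<in> f ` sphere 0 1 \<Longrightarrow> cmod x \<le> K"
    by (meson bounded_iff compact_imp_bounded)
  then show ?thesis
    by (intro integrable_arc_bounded[of _ K] borel_measurable_continuous_onI assms) auto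
qed

lemma parseval_trig_poly:
  "(\<integral>\<^sup>+\<zeta>. ennreal ((cmod (\<Sum>n<M. c n * \<zeta> ^ n))\<^sup>2) \<partial>arc_measure) = ennreal (\<Sum>n<M. (cmod (c n))\<^sup>2)"
proof -
  let ?p = "\<lambda>\<zeta>. \<Sum>n<M. c n * \<zeta> ^ n"
  have sq: "complex_of_real ((cmod (?p \<zeta>))\<^sup>2) = (\<Sum>n<M. \<Sum>m<M. c n * cnj (c m) * (\<zeta> ^ n * cnj (\<zeta> ^ m)))" for \<zeta>
    unfolding complex_norm_square by (simp add: sum_product mult_ac)
  have int: "integrable arc_measure (\<lambda>\<zeta>. complex_of_real ((cmod (?p \<zeta>))\<^sup>2))"
    by (intro integrable_arc_continuous continuous_intros)
  have "complex_of_real (LINT \<zeta>|arc_measure. (cmod (?p \<zeta>))\<^sup>2) = (LINT \<zeta>|arc_measure. complex_of_real ((cmod (?p \<zeta>))\<^sup>2))"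
    by (rule integral_complex_of_real [symmetric])
  also have "\<dots> = (\<Sum>n<M. \<Sum>m<M. c n * cnj (c m) * (LINT \<zeta>|arc_measure. \<zeta> ^ n * cnj (\<zeta> ^ m)))"
  proof -
    have int1: "integrable arc_measure (\<lambda>\<zeta>. c n * cnj (c m) * (\<zeta> ^ n * cnj (\<zeta> ^ m)))" for n m
      by (intro integrable_arc_continuous continuous_intros)
    have "(LINT \<zeta>|arc_measure. (\<Sum>n<M. \<Sum>m<M. c n * cnj (c m) * (\<zeta> ^ n * cnj (\<zeta> ^ m))))
        = (\<Sum>n<M. \<Sum>m<M. (LINT \<zeta>|arc_measure. c n * cnj (c m) * (\<zeta> ^ n * cnj (\<zeta> ^ m))))"
      using int1 by (simp only: Bochner_Integration.integral_sum Bochner_Integration.integrable_sum)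
    then show ?thesis unfolding sq integral_mult_right_zero .
  qed
  also have "\<dots> = complex_of_real (\<Sum>n<M. (cmod (c n))\<^sup>2)"
    by (simp add: integral_arc_power_cnj_power if_distrib[of "\<lambda>x. _ * x"] complex_norm_square
             del: complex_cnj_power of_real_power cong: if_cong)
  finally have eq: "(LINT \<zeta>|arc_measure. (cmod (?p \<zeta>))\<^sup>2) = (\<Sum>n<M. (cmod (c n))\<^sup>2)"
    unfolding of_real_eq_iff .
  have "integrable arc_measure (\<lambda>\<zeta>. (cmod (?p \<zeta>))\<^sup>2)"
    using int unfolding complex_of_real_integrable_eq .
  then show ?thesis by (subst nn_integral_eq_integral) (simp_all add: eq)
qed

section \<open>Radial limits and Fourier series\<close>

text \<open>A sequence of radii increasing to \<open>1\<close>; the convergence theorems for integrals concern sequences.\<close>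

definition rad :: "nat \<Rightarrow> real" where
  "rad k = 1 - 1 / real (k + 2)"

lemma rad_less_1: "0 < rad k" "rad k < 1"
  by (simp_all add: rad_def field_simps)

lemma rad_at_left: "filterlim rad (at_left 1) sequentially"
proof (rule tendsto_imp_filterlim_at_left)
  have "(\<lambda>k. 1 - 1 / real (k + 2)) \<longlonglongrightarrow> 1 - 0"
    by (intro tendsto_diff tendsto_const LIMSEQ_ignore_initial_segment[of "\<lambda>n. 1 / real n" 0 2] lim_1_over_n)
  then show "rad \<longlonglongrightarrow> 1"
    by (simp add: rad_def[abs_def])
qed (simp add: rad_less_1)

lemma rad_radial_limit:
  assumes "((\<lambda>t::real. f (of_real t * \<zeta>)) \<longlongrightarrow> L) (at_left 1)"
  shows "(\<lambda>k. f (of_real (rad k) * \<zeta>)) \<longlonglongrightarrow> L"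
  using filterlim_compose[OF assms rad_at_left] .

lemma norm_rad_mult: "cmod \<zeta> = 1 \<Longrightarrow> cmod (of_real (rad k) * \<zeta>) < 1"
  using rad_less_1[of k] by (simp add: norm_mult)

text \<open>A form of Fatou's lemma suited to almost everywhere limits of real functions.\<close>

lemma nn_integral_le_of_AE_tendsto:
  fixes u :: "nat \<Rightarrow> 'a \<Rightarrow> real"
  assumes "\<And>k. u k \<in> borel_measurable M"
    and lim: "AE x in M. (\<lambda>k. u k x) \<longlonglongrightarrow> v x"
    and le: "\<And>k. (\<integral>\<^sup>+x. ennreal (u k x) \<partial>M) \<le> C"
  shows "(\<integral>\<^sup>+x. ennreal (v x) \<partial>M) \<le> C"
proof -
  have "(\<integral>\<^sup>+x. ennreal (v x) \<partial>M) = (\<integral>\<^sup>+x. liminf (\<lambda>k. ennreal (u k x)) \<partial>M)"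
    using lim
    by (intro nn_integral_cong_AE, elim eventually_mono)
       (auto intro!: lim_imp_Liminf [symmetric] tendsto_ennrealI)
  also have "\<dots> \<le> liminf (\<lambda>k. (\<integral>\<^sup>+x. ennreal (u k x) \<partial>M))"
    using assms(1) by (intro nn_integral_liminf) simp
  also have "\<dots> \<le> C"
    using le by (intro Liminf_le) auto
  finally show ?thesis .
qed

text \<open>
Parseval bounds the mean square of each partial sum of the power series on each circle of radius
less than \<open>1\<close>.  Two applications of Fatou's lemma carry the bound over to the boundary: the first
lets the number of terms tend to infinity at a fixed radius, the second lets the radius tend to \<open>1\<close>.
Working with an abstract coefficient sequence makes the lemma applicable to differences and to
tails of Taylor series.
\<close>

lemma nn_integral_boundary_le:
  assumes sums: "\<And>z. cmod z < 1 \<Longrightarrow> (\<lambda>n. a n * z ^ n) sums f z"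
    and le: "\<And>M. (\<Sum>n<M. (cmod (a n))\<^sup>2) \<le> C"
    and lim: "AE \<zeta> in arc_measure. ((\<lambda>t::real. f (of_real t * \<zeta>)) \<longlongrightarrow> F \<zeta>) (at_left 1)"
  shows "(\<integral>\<^sup>+\<zeta>. ennreal ((cmod (F \<zeta>))\<^sup>2) \<partial>arc_measure) \<le> ennreal C"
proof (rule nn_integral_le_of_AE_tendsto)
  \<comment> \<open>The power series is measurable on the whole plane, whereas \<open>f\<close> is known only on the disc.\<close>
  let ?s = "\<lambda>k \<zeta>. \<Sum>n. a n * (of_real (rad k) * \<zeta>) ^ n"
  show "(\<lambda>\<zeta>. (cmod (?s k \<zeta>))\<^sup>2) \<in> borel_measurable arc_measure" for k by measurable
  have s: "?s k \<zeta> = f (of_real (rad k) * \<zeta>)" if "cmod \<zeta> = 1" for k \<zeta>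
    using sums_unique[OF sums[OF norm_rad_mult[OF that]]] by simp
  show "AE \<zeta> in arc_measure. (\<lambda>k. (cmod (?s k \<zeta>))\<^sup>2) \<longlonglongrightarrow> (cmod (F \<zeta>))\<^sup>2"
    using lim AE_arc_norm
    by eventually_elim (auto simp: s intro!: tendsto_intros rad_radial_limit)
  show "(\<integral>\<^sup>+\<zeta>. ennreal ((cmod (?s k \<zeta>))\<^sup>2) \<partial>arc_measure) \<le> ennreal C" for k
  proof (rule nn_integral_le_of_AE_tendsto)
    let ?p = "\<lambda>M \<zeta>. \<Sum>n<M. a n * of_real (rad k) ^ n * \<zeta> ^ n"
    show "(\<lambda>\<zeta>. (cmod (?p M \<zeta>))\<^sup>2) \<in> borel_measurable arc_measure" for M by measurable
    show "AE \<zeta> in arc_measure. (\<lambda>M. (cmod (?p M \<zeta>))\<^sup>2) \<longlonglongrightarrow> (cmod (?s k \<zeta>))\<^sup>2"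
      using AE_arc_norm
    proof eventually_elim
      fix \<zeta> :: complex assume "cmod \<zeta> = 1"
      from sums[OF norm_rad_mult[OF this, of k]] s[OF this, of k]
      have "(\<lambda>M. ?p M \<zeta>) \<longlonglongrightarrow> ?s k \<zeta>"
        by (simp add: sums_def power_mult_distrib mult_ac)
      then show "(\<lambda>M. (cmod (?p M \<zeta>))\<^sup>2) \<longlonglongrightarrow> (cmod (?s k \<zeta>))\<^sup>2"
        by (intro tendsto_intros)
    qed
    fix M
    have "(\<Sum>n<M. (cmod (a n * of_real (rad k) ^ n))\<^sup>2) \<le> (\<Sum>n<M. (cmod (a n))\<^sup>2)"
      using rad_less_1[of k]
      by (intro sum_mono power_mono) (auto simp: norm_mult norm_power intro!: mult_left_le power_le_one)
    also have "\<dots> \<le> C" by (rule le)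
    finally show "(\<integral>\<^sup>+\<zeta>. ennreal ((cmod (?p M \<zeta>))\<^sup>2) \<partial>arc_measure) \<le> ennreal C"
      unfolding parseval_trig_poly by (rule ennreal_leI)
  qed
qed

text \<open>
On a smaller circle the mean value property follows by integrating the power series term by term;
boundedness permits passing to the radial limit by dominated convergence.
\<close>

lemma mean_value_boundary:
  assumes hol: "v holomorphic_on ball 0 1"
    and bd: "\<And>z. cmod z < 1 \<Longrightarrow> cmod (v z) \<le> K"
    and [measurable]: "V \<in> borel_measurable borel"
    and lim: "AE \<zeta> in arc_measure. ((\<lambda>t::real. v (of_real t * \<zeta>)) \<longlongrightarrow> V \<zeta>) (at_left 1)"
  shows "(LINT \<zeta>|arc_measure. V \<zeta>) = v 0"
proof -
  define a where "a n = (deriv ^^ n) v 0 / fact n" for n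
  have sums: "(\<lambda>n. a n * z ^ n) sums v z" if "cmod z < 1" for z
    using holomorphic_power_series[OF hol, of z] that by (simp add: a_def)
  let ?s = "\<lambda>k \<zeta>. \<Sum>n. a n * (of_real (rad k) * \<zeta>) ^ n"
  have s: "?s k \<zeta> = v (of_real (rad k) * \<zeta>)" if "cmod \<zeta> = 1" for k \<zeta>
    using sums_unique[OF sums[OF norm_rad_mult[OF that]]] by simp
  have "(\<lambda>k. LINT \<zeta>|arc_measure. ?s k \<zeta>) \<longlonglongrightarrow> (LINT \<zeta>|arc_measure. V \<zeta>)"
  proof (rule integral_dominated_convergence[where w = "\<lambda>_. K"])
    show "AE \<zeta> in arc_measure. (\<lambda>k. ?s k \<zeta>) \<longlonglongrightarrow> V \<zeta>"
      using lim AE_arc_norm by eventually_elim (auto simp: s intro: rad_radial_limit)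
    show "AE \<zeta> in arc_measure. cmod (?s k \<zeta>) \<le> K" for k
      using AE_arc_norm by eventually_elim (auto simp: s intro!: bd norm_rad_mult)
  qed auto
  moreover have "(LINT \<zeta>|arc_measure. ?s k \<zeta>) = v 0" for k
  proof -
    obtain t where t: "rad k < t" "t < 1" using dense[OF rad_less_1(2)] by blast
    then have "cmod (of_real t) < 1" using rad_less_1[of k] by simp
    then have "summable (\<lambda>n. a n * of_real t ^ n)"
      by (rule sums_summable[OF sums])
    then have sm: "summable (\<lambda>n. cmod (a n * of_real (rad k) ^ n))"
      by (rule powser_insidea) (use t rad_less_1[of k] in simp)
    have norm: "cmod (a n * (of_real (rad k) * \<zeta>) ^ n) = cmod (a n * of_real (rad k) ^ n)"
      if "cmod \<zeta> = 1" for n \<zeta> using that by (simp add: norm_mult norm_power)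
    have "(LINT \<zeta>|arc_measure. ?s k \<zeta>) = (\<Sum>n. LINT \<zeta>|arc_measure. a n * (of_real (rad k) * \<zeta>) ^ n)"
    proof (rule integral_suminf)
      show "integrable arc_measure (\<lambda>\<zeta>. a n * (of_real (rad k) * \<zeta>) ^ n)" for n
        by (intro integrable_arc_continuous continuous_intros)
      show "AE \<zeta> in arc_measure. summable (\<lambda>n. cmod (a n * (of_real (rad k) * \<zeta>) ^ n))"
        using AE_arc_norm by eventually_elim (unfold norm, rule sm)
      have "(LINT \<zeta>|arc_measure. cmod (a n * (of_real (rad k) * \<zeta>) ^ n))
          = (LINT \<zeta>|arc_measure. cmod (a n * of_real (rad k) ^ n))" for n
        using AE_arc_norm by (intro integral_cong_AE; (elim eventually_mono)?) (auto simp: norm)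
      then show "summable (\<lambda>n. LINT \<zeta>|arc_measure. cmod (a n * (of_real (rad k) * \<zeta>) ^ n))"
        using sm by simp
    qed
    also have "(\<lambda>n. LINT \<zeta>|arc_measure. a n * (of_real (rad k) * \<zeta>) ^ n) = (\<lambda>n. if n = 0 then a 0 else 0)"
    proof
      fix n
      have "(LINT \<zeta>|arc_measure. a n * (of_real (rad k) * \<zeta>) ^ n)
         = (LINT \<zeta>|arc_measure. (a n * of_real (rad k) ^ n) * (\<zeta> ^ n * cnj (\<zeta> ^ 0)))"
        by (simp add: power_mult_distrib mult_ac)
      also have "\<dots> = (if n = 0 then a 0 else 0)"
        by (subst integral_mult_right_zero, subst integral_arc_power_cnj_power) simp
      finally show "(LINT \<zeta>|arc_measure. a n * (of_real (rad k) * \<zeta>) ^ n) = (if n = 0 then a 0 else 0)" .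
    qed
    also have "(\<Sum>n. if n = 0 then a 0 else 0) = a 0"
      by (subst suminf_finite[of "{0}"]) auto
    finally show ?thesis by (simp add: a_def)
  qed
  ultimately show ?thesis by (simp add: LIMSEQ_const_iff)
qed

text \<open>The Cauchy-Schwarz inequality against the constant \<open>1\<close>, the total mass being \<open>1\<close>.\<close>

lemma
  fixes F V :: "complex \<Rightarrow> complex"
  assumes [measurable]: "F \<in> borel_measurable borel" "V \<in> borel_measurable borel"
    and F: "(\<integral>\<^sup>+\<zeta>. ennreal ((cmod (F \<zeta>))\<^sup>2) \<partial>arc_measure) \<le> ennreal (c\<^sup>2)" and c: "0 \<le> c"
    and V: "AE \<zeta> in arc_measure. cmod (V \<zeta>) \<le> K"
  shows integrable_L2_times_bounded: "integrable arc_measure (\<lambda>\<zeta>. F \<zeta> * V \<zeta>)"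
    and integral_L2_times_bounded_le: "cmod (LINT \<zeta>|arc_measure. F \<zeta> * V \<zeta>) \<le> c * K"
proof -
  have K: "0 \<le> K"
  proof (rule ccontr)
    assume "\<not> 0 \<le> K"
    then have "AE \<zeta> in arc_measure. False"
      using V by (auto elim!: eventually_mono dest: order_trans[OF norm_ge_zero])
    then have "emeasure arc_measure UNIV = 0" by (auto simp: trivial_limit_def[symmetric] ae_filter_eq_bot_iff)
    then show False by (simp add: emeasure_arc_measure_UNIV)
  qed
  have "(\<integral>\<^sup>+\<zeta>. ennreal (cmod (F \<zeta>)) * 1 \<partial>arc_measure)\<^sup>2
      \<le> (\<integral>\<^sup>+\<zeta>. (ennreal (cmod (F \<zeta>)))\<^sup>2 \<partial>arc_measure) * (\<integral>\<^sup>+\<zeta>. 1\<^sup>2 \<partial>arc_measure)"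
    by (rule Cauchy_Schwarz_nn_integral) auto
  also have "\<dots> \<le> (ennreal c)\<^sup>2"
    using F c by (simp add: emeasure_arc_measure_UNIV ennreal_power)
  finally have 1: "(\<integral>\<^sup>+\<zeta>. ennreal (cmod (F \<zeta>)) \<partial>arc_measure) \<le> ennreal c"
    using c by (cases "\<integral>\<^sup>+\<zeta>. ennreal (cmod (F \<zeta>)) \<partial>arc_measure")
               (auto simp: ennreal_power top_power_ennreal top_unique intro: power2_le_imp_le)
  have "(\<integral>\<^sup>+\<zeta>. ennreal (cmod (F \<zeta> * V \<zeta>)) \<partial>arc_measure)
      \<le> (\<integral>\<^sup>+\<zeta>. ennreal (cmod (F \<zeta>)) * ennreal K \<partial>arc_measure)"
    using V by (intro nn_integral_mono_AE; (elim eventually_mono)?)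
               (auto simp: norm_mult simp flip: ennreal_mult' intro!: ennreal_leI mult_left_mono)
  also have "\<dots> = (\<integral>\<^sup>+\<zeta>. ennreal (cmod (F \<zeta>)) \<partial>arc_measure) * ennreal K"
    by (rule nn_integral_multc) auto
  also have "\<dots> \<le> ennreal (c * K)"
    using 1 K c by (auto simp: ennreal_mult intro: mult_right_mono)
  finally have le: "(\<integral>\<^sup>+\<zeta>. ennreal (cmod (F \<zeta> * V \<zeta>)) \<partial>arc_measure) \<le> ennreal (c * K)" .
  show int: "integrable arc_measure (\<lambda>\<zeta>. F \<zeta> * V \<zeta>)"
    by (rule integrableI_bounded) (use le in \<open>auto intro: le_less_trans\<close>)
  have "ennreal (cmod (LINT \<zeta>|arc_measure. F \<zeta> * V \<zeta>)) \<le> ennreal (c * K)"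
    using integral_norm_bound_ennreal[OF int] le by (rule order_trans)
  then show "cmod (LINT \<zeta>|arc_measure. F \<zeta> * V \<zeta>) \<le> c * K"
    using c K by (simp add: ennreal_le_iff)
qed

section \<open>Boundary functions of Hardy space elements\<close>

lemma isCont_radial_limit:
  fixes v :: "complex \<Rightarrow> complex"
  assumes "isCont v \<zeta>"
  shows "((\<lambda>t::real. v (of_real t * \<zeta>)) \<longlongrightarrow> v \<zeta>) (at_left 1)"
proof (rule isCont_tendsto_compose[OF assms])
  have "((\<lambda>t::real. of_real t * \<zeta>) \<longlongrightarrow> of_real 1 * \<zeta>) (at_left 1)"
    by (intro tendsto_intros)
  then show "((\<lambda>t::real. of_real t * \<zeta>) \<longlongrightarrow> \<zeta>) (at_left 1)" by simp
qed

lemma boundary_function_extend_by_zero: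
  assumes "v \<in> borel_measurable borel" and cont: "\<And>\<zeta>. cmod \<zeta> = 1 \<Longrightarrow> isCont v \<zeta>"
  shows "boundary_function (\<lambda>z. if z \<in> ball 0 1 then v z else 0) v"
  unfolding boundary_function_def
proof (intro conjI)
  show "AE \<zeta> in arc_measure. ((\<lambda>t::real. if of_real t * \<zeta> \<in> ball 0 1 then v (of_real t * \<zeta>) else 0) \<longlongrightarrow> v \<zeta>) (at_left 1)"
    using AE_arc_norm
  proof eventually_elim
    case (elim \<zeta>)
    have "\<forall>\<^sub>F t in at_left 1. v (of_real t * \<zeta>) = (if of_real t * \<zeta> \<in> ball 0 1 then v (of_real t * \<zeta>) else 0)"
      using eventually_at_left_real[of 0 "1::real", OF zero_less_one]
      by eventually_elim (auto simp: norm_mult elim)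
    then show ?case by (rule Lim_transform_eventually[OF isCont_radial_limit[OF cont[OF elim]]])
  qed
qed fact

lemma H2_sums:
  assumes "f \<in> H2" "cmod z < 1"
  shows "(\<lambda>n. taylor_coeff f n * z ^ n) sums f z"
  using holomorphic_power_series[of f 0 1 z] assms by (simp add: H2_def taylor_coeff_def)

text \<open>
Convergence of the Taylor series at a point outside the closed disc makes the coefficients
absolutely summable, hence square summable.
\<close>

lemma extend_by_zero_in_H2:
  assumes hol: "v holomorphic_on ball 0 R" and R: "1 < R"
  shows "(\<lambda>z. if z \<in> ball 0 1 then v z else 0) \<in> H2" (is "?u \<in> H2")
proof -
  have holu: "?u holomorphic_on ball 0 1"
    using R by (intro holomorphic_transform[OF holomorphic_on_subset[OF hol]]) auto
  have coeff: "taylor_coeff ?u n = (deriv ^^ n) v 0 / fact n" for n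
    unfolding taylor_coeff_def
    by (subst higher_deriv_transform_within_open[OF holu, of v 0])
       (use R in \<open>auto intro: holomorphic_on_subset[OF hol]\<close>)
  obtain t where t: "1 < t" "t < R" using dense[OF R] by blast
  then have "summable (\<lambda>n. (deriv ^^ n) v 0 / fact n * of_real t ^ n)"
    using sums_summable[OF holomorphic_power_series[OF hol, of "of_real t"]] by simp
  then have "summable (\<lambda>n. taylor_coeff ?u n * of_real t ^ n)"
    unfolding coeff .
  then have "summable (\<lambda>n. cmod (taylor_coeff ?u n * 1 ^ n))"
    by (rule powser_insidea) (use t in simp)
  then have sm: "summable (\<lambda>n. cmod (taylor_coeff ?u n))" by simp
  have "summable (\<lambda>n. (cmod (taylor_coeff ?u n))\<^sup>2)"
  proof (rule summable_comparison_test_ev[OF _ sm])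
    have "\<forall>\<^sub>F n in sequentially. cmod (taylor_coeff ?u n) < 1"
      using summable_LIMSEQ_zero[OF sm] by (rule order_tendstoD) simp
    then show "\<forall>\<^sub>F n in sequentially. norm ((cmod (taylor_coeff ?u n))\<^sup>2) \<le> cmod (taylor_coeff ?u n)"
      by eventually_elim (simp add: power2_eq_square mult_left_le)
  qed
  then have "(\<lambda>n. (cmod (taylor_coeff ?u n))\<^sup>2) summable_on UNIV"
    by (subst summable_on_UNIV_nonneg_real_iff) auto
  with holu show ?thesis unfolding H2_def by auto
qed

text \<open>
If \<open>f\<close> is replaced by a Taylor polynomial \<open>p\<close>, then \<open>p v\<close> is bounded analytic and vanishes at \<open>0\<close>, so
the mean value property applies.  The remainder \<open>F - p\<close> is small in \<open>L\<^sup>2\<close>, because \<open>f - p\<close> has the tail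
of the Taylor series as its coefficients, and \<open>V\<close> is bounded.
\<close>

lemma H2_times_bounded_mean_zero:
  assumes f: "f \<in> H2" "boundary_function f F"
    and v: "v holomorphic_on ball 0 1" "\<And>z. cmod z < 1 \<Longrightarrow> cmod (v z) \<le> K" "v 0 = 0"
    and V: "boundary_function v V"
  shows "(LINT \<zeta>|arc_measure. F \<zeta> * V \<zeta>) = 0"
proof -
  define a where "a = taylor_coeff f"
  have [measurable]: "F \<in> borel_measurable borel" "V \<in> borel_measurable borel"
    using f V by (auto simp: boundary_function_def)
  have limF: "AE \<zeta> in arc_measure. ((\<lambda>t::real. f (of_real t * \<zeta>)) \<longlongrightarrow> F \<zeta>) (at_left 1)"
    and limV: "AE \<zeta> in arc_measure. ((\<lambda>t::real. v (of_real t * \<zeta>)) \<longlongrightarrow> V \<zeta>) (at_left 1)"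
    using f V by (auto simp: boundary_function_def)
  have K: "0 \<le> K" using order_trans[OF norm_ge_zero v(2)[of 0]] by simp
  have VK: "AE \<zeta> in arc_measure. cmod (V \<zeta>) \<le> K"
    using limV AE_arc_norm
  proof eventually_elim
    case (elim \<zeta>)
    then show ?case
      by (intro LIMSEQ_le_const2[OF tendsto_norm[OF rad_radial_limit[OF elim(1)]]])
         (auto intro!: exI[of _ 0] v(2) norm_rad_mult)
  qed
  have sm: "summable (\<lambda>n. (cmod (a n))\<^sup>2)"
    using f(1) by (subst summable_on_UNIV_nonneg_real_iff [symmetric]) (auto simp: H2_def a_def)
  have le: "cmod (LINT \<zeta>|arc_measure. F \<zeta> * V \<zeta>) \<le> e * K" if e: "0 < e" for e
  proof -
    obtain M where M: "\<And>m n. m \<ge> M \<Longrightarrow> norm (\<Sum>n=m..<n. (cmod (a n))\<^sup>2) < e\<^sup>2"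
      using sm e unfolding summable_Cauchy by (meson zero_less_power)
    define p where "p z = (\<Sum>n<M. a n * z ^ n)" for z
    have [measurable]: "p \<in> borel_measurable borel" unfolding p_def by measurable
    have contp: "continuous_on A p" for A unfolding p_def by (intro continuous_intros)
    have limp: "((\<lambda>t::real. p (of_real t * \<zeta>)) \<longlongrightarrow> p \<zeta>) (at_left 1)" for \<zeta>
      unfolding p_def by (intro isCont_radial_limit continuous_intros)
    have tail: "(\<integral>\<^sup>+\<zeta>. ennreal ((cmod (F \<zeta> - p \<zeta>))\<^sup>2) \<partial>arc_measure) \<le> ennreal (e\<^sup>2)"
    proof (rule nn_integral_boundary_le)
      show "(\<lambda>n. (if n < M then 0 else a n) * z ^ n) sums (f z - p z)" if "cmod z < 1" for z
      proof -
        have "(\<lambda>n. a n * z ^ n - (if n \<in> {..<M} then a n * z ^ n else 0)) sums (f z - p z)"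
          unfolding p_def a_def by (intro sums_diff H2_sums f that sums_If_finite_set) simp
        then show ?thesis by (rule sums_cong[THEN iffD1, rotated]) auto
      qed
      show "(\<Sum>n<L. (cmod (if n < M then 0 else a n))\<^sup>2) \<le> e\<^sup>2" for L
      proof -
        have "(\<Sum>n<L. (cmod (if n < M then 0 else a n))\<^sup>2) = (\<Sum>n=M..<L. (cmod (a n))\<^sup>2)"
          by (intro sum.mono_neutral_cong_right) auto
        also have "\<dots> \<le> e\<^sup>2" using M[of M L] by simp
        finally show ?thesis .
      qed
      show "AE \<zeta> in arc_measure. ((\<lambda>t::real. f (of_real t * \<zeta>) - p (of_real t * \<zeta>)) \<longlongrightarrow> F \<zeta> - p \<zeta>) (at_left 1)"
        using limF by eventually_elim (intro tendsto_diff limp)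
    qed
    have "compact (p ` cball 0 1)" by (intro compact_continuous_image contp) simp
    then obtain Kp where "\<forall>y\<in>p ` cball 0 1. cmod y \<le> Kp"
      using compact_imp_bounded bounded_iff by metis
    then have Kp: "cmod (p z) \<le> Kp" if "cmod z \<le> 1" for z using that by simp
    have "(LINT \<zeta>|arc_measure. p \<zeta> * V \<zeta>) = p 0 * v 0"
    proof (rule mean_value_boundary)
      show "(\<lambda>z. p z * v z) holomorphic_on ball 0 1"
        unfolding p_def by (intro holomorphic_intros v)
      show "cmod (p z * v z) \<le> Kp * K" if "cmod z < 1" for z
        using that v(2)[of z] Kp[of z] order_trans[OF norm_ge_zero Kp[of z]]
        by (auto simp: norm_mult intro: mult_mono)
      show "AE \<zeta> in arc_measure. ((\<lambda>t::real. p (of_real t * \<zeta>) * v (of_real t * \<zeta>)) \<longlongrightarrow> p \<zeta> * V \<zeta>) (at_left 1)"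
        using limV by eventually_elim (intro tendsto_mult limp)
    qed measurable
    then have 0: "(LINT \<zeta>|arc_measure. p \<zeta> * V \<zeta>) = 0" using v by simp
    have intp: "integrable arc_measure (\<lambda>\<zeta>. p \<zeta> * V \<zeta>)"
    proof (rule arc.integrable_const_bound)
      show "AE \<zeta> in arc_measure. cmod (p \<zeta> * V \<zeta>) \<le> Kp * K"
        using AE_arc_norm VK
      proof eventually_elim
        case (elim \<zeta>)
        then show ?case using Kp[of \<zeta>] order_trans[OF norm_ge_zero Kp[of \<zeta>]]
          by (auto simp: norm_mult intro: mult_mono)
      qed
    qed measurable
    have inttail: "integrable arc_measure (\<lambda>\<zeta>. (F \<zeta> - p \<zeta>) * V \<zeta>)"
      by (rule integrable_L2_times_bounded[OF _ _ tail _ VK]) (use e in auto)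
    have "(LINT \<zeta>|arc_measure. F \<zeta> * V \<zeta>) = (LINT \<zeta>|arc_measure. (F \<zeta> - p \<zeta>) * V \<zeta> + p \<zeta> * V \<zeta>)"
      by (simp add: algebra_simps)
    also have "\<dots> = (LINT \<zeta>|arc_measure. (F \<zeta> - p \<zeta>) * V \<zeta>)"
      using inttail intp 0 by simp
    also have "cmod \<dots> \<le> e * K"
      by (rule integral_L2_times_bounded_le[OF _ _ tail _ VK]) (use e in auto)
    finally show ?thesis .
  qed
  have "cmod (LINT \<zeta>|arc_measure. F \<zeta> * V \<zeta>) \<le> 0"
  proof (rule field_le_epsilon)
    fix e :: real assume "0 < e"
    then have "cmod (LINT \<zeta>|arc_measure. F \<zeta> * V \<zeta>) \<le> e / (K + 1) * K"
      using K by (intro le) auto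
    also have "\<dots> \<le> e" using K \<open>0 < e\<close> by (simp add: field_simps)
    finally show "cmod (LINT \<zeta>|arc_measure. F \<zeta> * V \<zeta>) \<le> 0 + e" by simp
  qed
  then show ?thesis by simp
qed

lemma L2_circleD:
  assumes "F \<in> L2_circle"
  shows "F \<in> borel_measurable borel"
    and "\<exists>c\<ge>0. (\<integral>\<^sup>+\<zeta>. ennreal ((cmod (F \<zeta>))\<^sup>2) \<partial>arc_measure) \<le> ennreal (c\<^sup>2)"
proof -
  show "F \<in> borel_measurable borel" using assms by (simp add: L2_circle_def)
  have "integrable arc_measure (\<lambda>\<zeta>. (cmod (F \<zeta>))\<^sup>2)" using assms by (simp add: L2_circle_def)
  then have "(\<integral>\<^sup>+\<zeta>. ennreal ((cmod (F \<zeta>))\<^sup>2) \<partial>arc_measure) = ennreal (LINT \<zeta>|arc_measure. (cmod (F \<zeta>))\<^sup>2)"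
    by (intro nn_integral_eq_integral) auto
  then show "\<exists>c\<ge>0. (\<integral>\<^sup>+\<zeta>. ennreal ((cmod (F \<zeta>))\<^sup>2) \<partial>arc_measure) \<le> ennreal (c\<^sup>2)"
    by (intro exI[of _ "sqrt (LINT \<zeta>|arc_measure. (cmod (F \<zeta>))\<^sup>2)"]) simp
qed

lemma nn_integral_boundary_diff_le:
  assumes f: "f \<in> H2" "boundary_function f F" and g: "g \<in> H2" "boundary_function g G"
  shows "(\<integral>\<^sup>+\<zeta>. ennreal ((cmod (F \<zeta> - G \<zeta>))\<^sup>2) \<partial>arc_measure) \<le> ennreal ((H2_dist f g)\<^sup>2)"
proof (rule nn_integral_boundary_le)
  show "(\<lambda>n. (taylor_coeff f n - taylor_coeff g n) * z ^ n) sums (f z - g z)" if "cmod z < 1" for z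
    unfolding left_diff_distrib using that by (intro sums_diff H2_sums f g)
  have "(\<lambda>n. (cmod (taylor_coeff f n - taylor_coeff g n))\<^sup>2) summable_on UNIV"
    using f g by (intro square_summable_diff) (auto simp: H2_def)
  then have "(\<Sum>n<M. (cmod (taylor_coeff f n - taylor_coeff g n))\<^sup>2)
      \<le> (\<Sum>\<^sub>\<infinity>n. (cmod (taylor_coeff f n - taylor_coeff g n))\<^sup>2)" for M
    by (intro finite_sum_le_infsum) auto
  then show "(\<Sum>n<M. (cmod (taylor_coeff f n - taylor_coeff g n))\<^sup>2) \<le> (H2_dist f g)\<^sup>2" for M
    unfolding H2_dist_def by (subst real_sqrt_pow2) (auto intro: infsum_nonneg)
  have "AE \<zeta> in arc_measure. ((\<lambda>t::real. f (of_real t * \<zeta>)) \<longlongrightarrow> F \<zeta>) (at_left 1)"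
       "AE \<zeta> in arc_measure. ((\<lambda>t::real. g (of_real t * \<zeta>)) \<longlongrightarrow> G \<zeta>) (at_left 1)"
    using f g by (auto simp: boundary_function_def)
  then show "AE \<zeta> in arc_measure. ((\<lambda>t::real. f (of_real t * \<zeta>) - g (of_real t * \<zeta>)) \<longlongrightarrow> F \<zeta> - G \<zeta>) (at_left 1)"
    by eventually_elim (rule tendsto_diff)
qed

section \<open>Eigenfunctionals obstruct hypercyclicity\<close>

lemma integrable_boundary_times_cnj_bounded:
  assumes f: "f \<in> H2" "boundary_function f F"
    and U: "U \<in> borel_measurable borel" "AE \<zeta> in arc_measure. cmod (U \<zeta>) \<le> K"
  shows "integrable arc_measure (\<lambda>\<zeta>. F \<zeta> * cnj (U \<zeta>))"
proof -
  have [measurable]: "U \<in> borel_measurable borel" using U by simp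
  have 0: "(\<lambda>_. 0) \<in> H2" using extend_by_zero_in_H2[of "\<lambda>_. 0" 2] by simp
  have "(\<integral>\<^sup>+\<zeta>. ennreal ((cmod (F \<zeta> - 0))\<^sup>2) \<partial>arc_measure) \<le> ennreal ((H2_dist f (\<lambda>_. 0))\<^sup>2)"
    using f 0 by (rule nn_integral_boundary_diff_le) (simp add: boundary_function_def)
  then show ?thesis using f U
    by (intro integrable_L2_times_bounded) (auto simp: boundary_function_def)
qed

text \<open>
Pairing boundary values with a bounded function is Lipschitz for the \<open>H\<^sup>2\<close> distance.  For \<open>f = g\<close> this
also shows that the pairing does not depend on the choice of the boundary function.
\<close>

lemma inner_L2_boundary_diff_le:
  assumes f: "f \<in> H2" "boundary_function f F" and g: "g \<in> H2" "boundary_function g G"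
    and U: "U \<in> borel_measurable borel" "AE \<zeta> in arc_measure. cmod (U \<zeta>) \<le> K"
  shows "cmod (inner_L2 F U - inner_L2 G U) \<le> H2_dist f g * K"
proof -
  have [measurable]: "F \<in> borel_measurable borel" "G \<in> borel_measurable borel" "U \<in> borel_measurable borel"
    using f g U by (auto simp: boundary_function_def)
  have U': "AE \<zeta> in arc_measure. cmod (cnj (U \<zeta>)) \<le> K" using U by simp
  have int: "integrable arc_measure (\<lambda>\<zeta>. E \<zeta> * cnj (U \<zeta>))" if "e \<in> H2" "boundary_function e E" for e E
    using that U by (rule integrable_boundary_times_cnj_bounded)
  have "inner_L2 F U - inner_L2 G U = (LINT \<zeta>|arc_measure. (F \<zeta> - G \<zeta>) * cnj (U \<zeta>))"
    unfolding inner_L2_def using int[OF f] int[OF g] by (simp add: left_diff_distrib)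
  also have "cmod \<dots> \<le> H2_dist f g * K"
    by (rule integral_L2_times_bounded_le[OF _ _ nn_integral_boundary_diff_le[OF f g] _ U']) auto
  finally show ?thesis .
qed

text \<open>
If \<open>l = 0\<close> or \<open>\<bar>w\<bar> \<le> 1\<close>, all the numbers \<open>w ^ n * l\<close> lie in the closed disc of radius \<open>\<bar>l\<bar>\<close> about \<open>0\<close>;
otherwise all of them stay out of the open one.
\<close>

lemma powers_times_not_dense:
  fixes w l :: complex
  shows "\<exists>c. \<exists>e>0. \<forall>n. e \<le> cmod (c - w ^ n * l)"
proof (cases "l = 0 \<or> cmod w \<le> 1")
  case True
  then have le: "cmod (w ^ n * l) \<le> cmod l" for n
    by (cases "l = 0") (auto simp: norm_mult norm_power intro!: mult_left_le_one_le power_le_one)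
  have "1 \<le> cmod (of_real (cmod l + 1) - w ^ n * l)" for n
  proof -
    have "cmod l + 1 = cmod (complex_of_real (cmod l + 1))" unfolding norm_of_real by simp
    also have "\<dots> \<le> cmod (of_real (cmod l + 1) - w ^ n * l) + cmod (w ^ n * l)"
      using norm_triangle_ineq[of "of_real (cmod l + 1) - w ^ n * l" "w ^ n * l"] by simp
    finally show ?thesis using le[of n] by simp
  qed
  then show ?thesis using zero_less_one by blast
next
  case False
  then have "cmod l \<le> cmod (0 - w ^ n * l)" for n
    by (auto simp: norm_mult norm_power)
  moreover have "0 < cmod l" using False by simp
  ultimately show ?thesis by blast
qed

text \<open>
The functional \<open>L f = \<langle>f, U\<rangle>\<close> takes the orbit of \<open>x\<close> to the numbers \<open>w ^ n * L x\<close>.  It is Lipschitz, and it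
takes all complex values on constants, because it does not vanish at \<open>1\<close>; so a dense orbit would make
those numbers dense in the plane.
\<close>

lemma eigenfunctional_not_hypercyclic:
  assumes U: "U \<in> borel_measurable borel" "AE \<zeta> in arc_measure. cmod (U \<zeta>) \<le> K"
    and one: "inner_L2 (\<lambda>_. 1) U \<noteq> 0"
    and eigen: "\<And>f. f \<in> H2 \<Longrightarrow> T f \<in> H2 \<and>
      (\<exists>F G. boundary_function f F \<and> boundary_function (T f) G \<and> inner_L2 G U = w * inner_L2 F U)"
    and x: "x \<in> H2" "H2.mtopology closure_of (range (\<lambda>n. (T ^^ n) x)) = H2"
  shows False
proof -
  define L where "L f = inner_L2 (SOME F. boundary_function f F) U" for f
  have some: "boundary_function f (SOME F. boundary_function f F)" if "f \<in> H2" for f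
  proof -
    have "\<exists>F. boundary_function f F" using eigen[OF that] by blast
    then show ?thesis by (rule someI_ex)
  qed
  have L: "L f = inner_L2 F U" if "f \<in> H2" "boundary_function f F" for f F
  proof -
    have "cmod (inner_L2 (SOME F. boundary_function f F) U - inner_L2 F U) \<le> H2_dist f f * K"
      using that some U by (intro inner_L2_boundary_diff_le) auto
    then show ?thesis using that by (simp add: L_def)
  qed
  have cont: "cmod (L f - L g) \<le> H2_dist f g * K" if "f \<in> H2" "g \<in> H2" for f g
    unfolding L_def using that some U by (intro inner_L2_boundary_diff_le) auto
  have LT: "L (T f) = w * L f" if "f \<in> H2" for f
    using eigen[OF that] that by (auto simp: L)
  have orbit: "(T ^^ n) x \<in> H2 \<and> L ((T ^^ n) x) = w ^ n * L x" for n
    by (induction n) (use eigen x(1) LT in auto)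
  define one_fun :: "complex \<Rightarrow> complex \<Rightarrow> complex"
    where "one_fun c z = (if z \<in> ball 0 1 then c else 0)" for c z
  have const: "one_fun c \<in> H2" "L (one_fun c) = c * inner_L2 (\<lambda>_. 1) U" for c
  proof -
    show H2: "one_fun c \<in> H2"
      unfolding one_fun_def using extend_by_zero_in_H2[of "\<lambda>_. c" 2] by simp
    have "boundary_function (one_fun c) (\<lambda>_. c)"
      unfolding one_fun_def by (rule boundary_function_extend_by_zero) auto
    then have "L (one_fun c) = inner_L2 (\<lambda>_. c) U" by (rule L[OF H2])
    then show "L (one_fun c) = c * inner_L2 (\<lambda>_. 1) U"
      by (simp add: inner_L2_def)
  qed
  obtain c e where e: "e > 0" "\<And>n. e \<le> cmod (c - w ^ n * L x)"
    using powers_times_not_dense by metis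
  \<comment> \<open>A constant on which the functional takes the value \<open>c\<close>, which the powers keep away from.\<close>
  define f where "f = one_fun (c / inner_L2 (\<lambda>_. 1) U)"
  have f: "f \<in> H2" "L f = c" using const one by (auto simp: f_def)
  define d where "d = e / (\<bar>K\<bar> + 1)"
  have "d > 0" using e by (simp add: d_def add_nonneg_pos)
  moreover have "f \<in> H2.mtopology closure_of (range (\<lambda>n. (T ^^ n) x))"
    using f x by simp
  ultimately obtain n where n: "H2_dist f ((T ^^ n) x) < d"
    unfolding H2.metric_closure_of by (auto simp: H2.in_mball)
  have "e \<le> cmod (L f - L ((T ^^ n) x))" using e orbit f by simp
  also have "\<dots> \<le> H2_dist f ((T ^^ n) x) * K" using cont f orbit by blast
  also have "\<dots> \<le> H2_dist f ((T ^^ n) x) * \<bar>K\<bar>"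
    using H2.nonneg by (intro mult_left_mono) auto
  also have "\<dots> \<le> d * \<bar>K\<bar>" using n by (intro mult_right_mono) auto
  also have "\<dots> < e" using e by (simp add: d_def field_simps)
  finally show False by simp
qed

section \<open>An eigenfunction of the adjoint Toeplitz operator\<close>

text \<open>
The polynomial \<open>p\<^sup>*(z) = z ^ n * cnj (p (1 / cnj z))\<close>, with \<open>n\<close> the degree of \<open>p\<close>: its roots are the
mirror images in the unit circle of the nonzero roots of \<open>p\<close> (for \<open>p \<noteq> 0\<close>).
\<close>

definition conj_reflect :: "complex poly \<Rightarrow> complex poly" where
  "conj_reflect p = reflect_poly (map_poly cnj p)"

lemma poly_conj_reflect:
  assumes "z \<noteq> 0"
  shows "poly (conj_reflect p) z = z ^ degree p * cnj (poly p (1 / cnj z))"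
  using assms by (simp add: conj_reflect_def poly_reflect_poly_nz degree_map_poly inverse_eq_divide)

lemma poly_conj_reflect_0: "poly (conj_reflect p) 0 = cnj (lead_coeff p)"
  by (simp add: conj_reflect_def degree_map_poly coeff_map_poly)

lemma poly_conj_reflect_circle:
  assumes "cmod \<zeta> = 1"
  shows "poly (conj_reflect p) \<zeta> = \<zeta> ^ degree p * cnj (poly p \<zeta>)"
proof -
  have "\<zeta> * cnj \<zeta> = 1" using assms by (simp add: complex_norm_square [symmetric])
  moreover have "\<zeta> \<noteq> 0" using assms by auto
  ultimately have "1 / cnj \<zeta> = \<zeta>" "\<zeta> \<noteq> 0" by (simp_all add: divide_eq_eq)
  then show ?thesis by (simp add: poly_conj_reflect)
qed

text \<open>
Reflection in the circle moves the roots of \<open>b\<close> from the disc to its exterior; the value at \<open>0\<close>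
is the conjugate of the leading coefficient.
\<close>

lemma conj_reflect_nonzero:
  assumes "b \<noteq> 0" "\<And>z. poly b z = 0 \<Longrightarrow> cmod z < 1" "cmod z \<le> 1"
  shows "poly (conj_reflect b) z \<noteq> 0"
proof (cases "z = 0")
  case False
  then have "1 \<le> cmod (1 / cnj z)" using assms(3) by (simp add: norm_divide field_simps)
  with assms(2) have "poly b (1 / cnj z) \<noteq> 0" by fastforce
  with False show ?thesis by (simp add: poly_conj_reflect)
qed (use assms in \<open>simp add: poly_conj_reflect_0\<close>)

text \<open>
The quotient \<open>U = B\<^sup>* / b\<^sup>*\<close> of the reflected polynomials is an eigenvector of the adjoint of \<open>T\<close> as soon
as \<open>b\<close> has larger degree than \<open>B\<close>.  The equation relating \<open>\<Phi>\<close> and \<open>h\<close> leaves out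
the roots of \<open>B\<close>, because \<open>\<Phi>\<close> may have poles there.
\<close>

lemma toeplitz_hypercyclic_zero_bound:
  assumes \<psi>: "boundary_function \<Phi> \<psi>" and T: "toeplitz_operator \<psi> T" "hypercyclic_on_H2 T"
    and b: "b \<noteq> 0" "\<And>z. poly b z = 0 \<Longrightarrow> cmod z < 1"
    and B: "B \<noteq> 0" "\<And>z. poly B z = 0 \<Longrightarrow> cmod z < 1"
    and h: "h \<in> H_inf"
    and eq: "\<And>z. cmod z < 1 \<Longrightarrow> poly B z \<noteq> 0 \<Longrightarrow> poly B z * (\<Phi> z - w) = poly b z * h z"
  shows "degree b \<le> degree B"
proof (rule ccontr)
  assume "\<not> degree b \<le> degree B"
  define d where "d = degree b - degree B"
  have d: "d > 0" "degree b = d + degree B"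
    using \<open>\<not> degree b \<le> degree B\<close> by (simp_all add: d_def)
  define U where "U z = poly (conj_reflect B) z / poly (conj_reflect b) z" for z
  have bs: "poly (conj_reflect b) z \<noteq> 0" if "cmod z \<le> 1" for z
    by (rule conj_reflect_nonzero) (use b that in auto)
  define Z where "Z = {z. poly (conj_reflect b) z = 0}"
  have "finite Z"
    unfolding Z_def using bs[of 0] by (intro poly_roots_finite) auto
  \<comment> \<open>The number \<open>2\<close> only makes the minimum well defined when \<open>b\<^sup>*\<close> has no roots.\<close>
  define R where "R = Min (insert 2 (cmod ` Z))"
  have R: "1 < R"
    unfolding R_def using bs \<open>finite Z\<close> by (subst Min_gr_iff) (auto simp: Z_def not_le[symmetric])
  have "poly (conj_reflect b) z \<noteq> 0" if "z \<in> ball 0 R" for z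
  proof
    assume "poly (conj_reflect b) z = 0"
    then have "R \<le> cmod z" unfolding R_def using \<open>finite Z\<close> by (intro Min_le) (auto simp: Z_def)
    with that show False by simp
  qed
  then have holU: "U holomorphic_on ball 0 R"
    unfolding U_def by (intro holomorphic_intros) auto
  have [measurable]: "poly p \<in> borel_measurable borel" for p :: "complex poly"
    by (intro borel_measurable_continuous_onI continuous_intros)
  have U_meas [measurable]: "U \<in> borel_measurable borel"
    unfolding U_def by measurable
  have contU: "isCont U z" if "cmod z \<le> 1" for z
    unfolding U_def using bs[OF that] by (intro continuous_intros)
  have "compact (U ` cball 0 1)"
    by (intro compact_continuous_image continuous_at_imp_continuous_on) (auto intro: contU)
  then obtain K where "\<forall>y\<in>U ` cball 0 1. cmod y \<le> K"
    using compact_imp_bounded bounded_iff by metis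
  then have K: "cmod (U z) \<le> K" if "cmod z \<le> 1" for z using that by simp
  have UK: "AE \<zeta> in arc_measure. cmod (U \<zeta>) \<le> K"
    using AE_arc_norm by eventually_elim (simp add: K)
  \<comment> \<open>The orthogonality that defines the projection can be tested only against elements of \<open>H\<^sup>2\<close>.\<close>
  have U_H2: "U \<in> H2_circle"
    unfolding H2_circle_def L2_circle_def
  proof (intro CollectI conjI bexI)
    show "boundary_function (\<lambda>z. if z \<in> ball 0 1 then U z else 0) U"
      by (rule boundary_function_extend_by_zero) (auto intro: contU)
    show "(\<lambda>z. if z \<in> ball 0 1 then U z else 0) \<in> H2"
      by (rule extend_by_zero_in_H2[OF holU R])
    show "integrable arc_measure (\<lambda>\<zeta>. (cmod (U \<zeta>))\<^sup>2)"
    proof (rule arc.integrable_const_bound)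
      show "AE \<zeta> in arc_measure. norm ((cmod (U \<zeta>))\<^sup>2) \<le> K\<^sup>2"
        using UK by eventually_elim (auto intro: power_mono)
    qed measurable
  qed fact
  \<comment> \<open>On the circle \<open>cnj \<zeta> = 1 / \<zeta>\<close>, so the factors \<open>\<zeta> ^ degree\<close> of the two reflected polynomials combine to \<open>\<zeta> ^ d\<close>.\<close>
  have cnjU: "cnj (U \<zeta>) = \<zeta> ^ d * poly B \<zeta> / poly b \<zeta>" if "cmod \<zeta> = 1" for \<zeta>
  proof -
    have "\<zeta> * cnj \<zeta> = 1" using that by (simp add: complex_norm_square [symmetric])
    then have 1: "\<zeta> ^ d * cnj \<zeta> ^ d = 1" by (metis power_mult_distrib power_one)
    have "\<zeta> \<noteq> 0" using that by auto
    have "poly b \<zeta> \<noteq> 0" using b(2)[of \<zeta>] that by auto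
    have "cnj (U \<zeta>) = poly B \<zeta> / (cnj \<zeta> ^ d * poly b \<zeta>)"
      using \<open>\<zeta> \<noteq> 0\<close> that by (simp add: U_def poly_conj_reflect_circle d power_add)
    also have "\<dots> = \<zeta> ^ d * cnj \<zeta> ^ d * poly B \<zeta> / (cnj \<zeta> ^ d * poly b \<zeta>)"
      unfolding 1 by simp
    also have "\<dots> = \<zeta> ^ d * poly B \<zeta> / poly b \<zeta>"
      using \<open>\<zeta> \<noteq> 0\<close> by simp
    finally show ?thesis .
  qed
  have "(LINT \<zeta>|arc_measure. U \<zeta>) = U 0"
  proof (rule mean_value_boundary[where K = K])
    show "U holomorphic_on ball 0 1" using R by (intro holomorphic_on_subset[OF holU]) auto
    show "AE \<zeta> in arc_measure. ((\<lambda>t::real. U (of_real t * \<zeta>)) \<longlongrightarrow> U \<zeta>) (at_left 1)"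
      using AE_arc_norm by eventually_elim (intro isCont_radial_limit contU, simp)
  qed (use K in auto)
  moreover have "U 0 \<noteq> 0" using b B by (simp add: U_def poly_conj_reflect_0)
  ultimately have one: "inner_L2 (\<lambda>_. 1) U \<noteq> 0"
    by (simp add: inner_L2_def)
  have \<psi>_meas [measurable]: "\<psi> \<in> borel_measurable borel"
    using \<psi> by (simp add: boundary_function_def)
  \<comment> \<open>On the circle \<open>(\<psi> - w) * cnj U\<close> is the boundary function of a function that vanishes at \<open>0\<close>.\<close>
  define v where "v z = z ^ d * h z" for z
  obtain Kh where Kh: "\<forall>y\<in>h ` ball 0 1. cmod y \<le> Kh"
    using h bounded_iff unfolding H_inf_def by blast
  have v: "v holomorphic_on ball 0 1" "cmod (v z) \<le> Kh" "v 0 = 0" if "cmod z < 1" for z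
  proof -
    show "v holomorphic_on ball 0 1"
      using h unfolding v_def H_inf_def by (auto intro!: holomorphic_intros)
    have "cmod z ^ d * cmod (h z) \<le> cmod (h z)"
      using that by (intro mult_left_le_one_le) (auto intro: power_le_one)
    also have "\<dots> \<le> Kh" using Kh that by auto
    finally show "cmod (v z) \<le> Kh" by (simp add: v_def norm_mult norm_power)
    show "v 0 = 0" using d by (simp add: v_def)
  qed
  have V: "boundary_function v (\<lambda>\<zeta>. (\<psi> \<zeta> - w) * cnj (U \<zeta>))"
    unfolding boundary_function_def
  proof
    show "AE \<zeta> in arc_measure. ((\<lambda>t::real. v (of_real t * \<zeta>)) \<longlongrightarrow> (\<psi> \<zeta> - w) * cnj (U \<zeta>)) (at_left 1)"
      using AE_arc_norm \<psi>[unfolded boundary_function_def, THEN conjunct2]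
    proof eventually_elim
      case (elim \<zeta>)
      have lim: "((\<lambda>t::real. poly p (of_real t * \<zeta>)) \<longlongrightarrow> poly p \<zeta>) (at_left 1)" for p
        by (intro isCont_radial_limit continuous_intros)
      have nz: "poly b \<zeta> \<noteq> 0" "poly B \<zeta> \<noteq> 0" using b(2)[of \<zeta>] B(2)[of \<zeta>] elim(1) by auto
      have "((\<lambda>t::real. (of_real t * \<zeta>) ^ d * poly B (of_real t * \<zeta>) * (\<Phi> (of_real t * \<zeta>) - w) / poly b (of_real t * \<zeta>))
          \<longlongrightarrow> \<zeta> ^ d * poly B \<zeta> * (\<psi> \<zeta> - w) / poly b \<zeta>) (at_left 1)"
        by (intro tendsto_intros lim nz elim(2) isCont_radial_limit[where v = "\<lambda>z. z ^ d"] continuous_intros)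
      moreover have "\<forall>\<^sub>F t in at_left 1.
         (of_real t * \<zeta>) ^ d * poly B (of_real t * \<zeta>) * (\<Phi> (of_real t * \<zeta>) - w) / poly b (of_real t * \<zeta>)
         = v (of_real t * \<zeta>)"
        using eventually_at_left_real[of 0 "1::real", OF zero_less_one]
          tendsto_imp_eventually_ne[OF lim nz(1)] tendsto_imp_eventually_ne[OF lim nz(2)]
      proof eventually_elim
        case (elim t)
        then have "cmod (of_real t * \<zeta>) < 1" using \<open>cmod \<zeta> = 1\<close> by (simp add: norm_mult)
        from eq[OF this elim(3)] elim(2) show ?case
          by (simp add: v_def mult.assoc)
      qed
      ultimately have "((\<lambda>t::real. v (of_real t * \<zeta>)) \<longlongrightarrow> \<zeta> ^ d * poly B \<zeta> * (\<psi> \<zeta> - w) / poly b \<zeta>) (at_left 1)"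
        by (rule Lim_transform_eventually)
      then show ?case by (simp add: cnjU[OF elim(1)] mult_ac)
    qed
  qed measurable
  have int: "integrable arc_measure (\<lambda>\<zeta>. E \<zeta> * cnj (U \<zeta>))" if E: "E \<in> L2_circle" for E
  proof -
    obtain c where c: "c \<ge> 0" "(\<integral>\<^sup>+\<zeta>. ennreal ((cmod (E \<zeta>))\<^sup>2) \<partial>arc_measure) \<le> ennreal (c\<^sup>2)"
      using L2_circleD[OF E] by blast
    show ?thesis
      by (rule integrable_L2_times_bounded[OF _ _ c(2,1), of _ K]) (use L2_circleD[OF E] UK in auto)
  qed
  obtain x where x: "x \<in> H2" "H2.mtopology closure_of (range (\<lambda>n. (T ^^ n) x)) = H2"
    using T by (auto simp: hypercyclic_on_H2_def)
  have eigen: "T f \<in> H2 \<and>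
      (\<exists>F G. boundary_function f F \<and> boundary_function (T f) G \<and> inner_L2 G U = w * inner_L2 F U)"
    if f: "f \<in> H2" for f
  proof -
    obtain F G where FG: "boundary_function f F" "boundary_function (T f) G"
        "P_plus (\<lambda>\<zeta>. \<psi> \<zeta> * F \<zeta>) G" and Tf: "T f \<in> H2"
      using T f unfolding toeplitz_operator_def by blast
    have L2: "(\<lambda>\<zeta>. \<psi> \<zeta> * F \<zeta>) \<in> L2_circle" "G \<in> L2_circle"
      and orth: "inner_L2 (\<lambda>\<zeta>. \<psi> \<zeta> * F \<zeta> - G \<zeta>) U = 0"
      using FG(3) U_H2 by (auto simp: P_plus_def H2_circle_def)
    have intF: "integrable arc_measure (\<lambda>\<zeta>. F \<zeta> * cnj (U \<zeta>))"
      by (rule integrable_boundary_times_cnj_bounded[OF f FG(1) U_meas UK])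
    have 1: "(LINT \<zeta>|arc_measure. \<psi> \<zeta> * F \<zeta> * cnj (U \<zeta>)) = inner_L2 G U"
      using orth int[OF L2(1)] int[OF L2(2)] by (simp add: inner_L2_def left_diff_distrib)
    have "0 = (LINT \<zeta>|arc_measure. F \<zeta> * ((\<psi> \<zeta> - w) * cnj (U \<zeta>)))"
      by (rule H2_times_bounded_mean_zero[OF f FG(1) _ _ _ V, symmetric, of Kh])
         (use v[of 0] v(2) in auto)
    also have "\<dots> = (LINT \<zeta>|arc_measure. \<psi> \<zeta> * F \<zeta> * cnj (U \<zeta>) - w * (F \<zeta> * cnj (U \<zeta>)))"
      by (simp add: algebra_simps)
    also have "\<dots> = inner_L2 G U - w * inner_L2 F U"
      using int[OF L2(1)] intF 1 by (simp add: inner_L2_def)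
    finally have "inner_L2 G U = w * inner_L2 F U" by simp
    with FG Tf show ?thesis by blast
  qed
  show False
    by (rule eigenfunctional_not_hypercyclic[OF U_meas UK one eigen x])
qed

section \<open>Zeros of bounded analytic functions\<close>

lemma H_inf_iff_bound:
  "h \<in> H_inf \<longleftrightarrow> h holomorphic_on ball 0 1 \<and> (\<exists>K. \<forall>z. cmod z < 1 \<longrightarrow> cmod (h z) \<le> K)"
proof -
  have "(\<forall>y\<in>h ` ball 0 1. cmod y \<le> K) \<longleftrightarrow> (\<forall>z. cmod z < 1 \<longrightarrow> cmod (h z) \<le> K)" for K
    by auto
  then show ?thesis by (simp add: H_inf_def bounded_iff)
qed

lemma H_inf_add:
  assumes "f \<in> H_inf" "g \<in> H_inf"
  shows "(\<lambda>z. f z + g z) \<in> H_inf"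
  using assms unfolding H_inf_def
  by (auto intro!: holomorphic_intros bounded_plus_comp)

lemma H_inf_mult:
  assumes "f \<in> H_inf" "g \<in> H_inf"
  shows "(\<lambda>z. f z * g z) \<in> H_inf"
proof -
  obtain K L where "\<And>z. cmod z < 1 \<Longrightarrow> cmod (f z) \<le> K" "\<And>z. cmod z < 1 \<Longrightarrow> cmod (g z) \<le> L"
    using assms unfolding H_inf_iff_bound by metis
  then have "cmod (f z * g z) \<le> K * L" if "cmod z < 1" for z
    using that by (auto simp: norm_mult intro!: mult_mono dest: order_trans[OF norm_ge_zero])
  then show ?thesis using assms unfolding H_inf_iff_bound by (auto intro!: holomorphic_intros)
qed

lemma H_inf_poly: "poly p \<in> H_inf"
proof -
  have "compact (poly p ` cball 0 1)"
    by (intro compact_continuous_image continuous_intros) auto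
  then have "bounded (poly p ` ball 0 1)"
    by (intro bounded_subset[OF compact_imp_bounded]) auto
  then show ?thesis unfolding H_inf_def by (auto intro!: holomorphic_intros)
qed

text \<open>
The quotient is bounded near the circle because \<open>z - a\<close> is bounded away from \<open>0\<close> there, and bounded on
the remaining compact disc by continuity.
\<close>

lemma H_inf_divide_zero:
  assumes h: "h \<in> H_inf" and a: "cmod a < 1" "h a = 0"
  obtains h' where "h' \<in> H_inf" "\<And>z. h z = (z - a) * h' z"
proof -
  define h' where "h' z = (if z = a then deriv h a else h z / (z - a))" for z
  have hol: "h' holomorphic_on ball 0 1"
    using pole_lemma_open[of h "ball 0 1" a] h a by (simp add: H_inf_def h'_def[abs_def] cong: if_cong)
  obtain K where K: "\<And>z. cmod z < 1 \<Longrightarrow> cmod (h z) \<le> K"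
    using h unfolding H_inf_iff_bound by metis
  obtain s where s: "cmod a < s" "s < 1" using dense[OF a(1)] by blast
  have "compact (h' ` cball 0 s)"
    using s by (intro compact_continuous_image holomorphic_on_imp_continuous_on
                  holomorphic_on_subset[OF hol]) auto
  then obtain K' where "\<forall>y\<in>h' ` cball 0 s. cmod y \<le> K'"
    using compact_imp_bounded bounded_iff by metis
  then have K': "cmod (h' z) \<le> K'" if "cmod z \<le> s" for z using that by simp
  have "cmod (h' z) \<le> max K' (K / (s - cmod a))" if z: "cmod z < 1" for z
  proof (cases "cmod z \<le> s")
    case False
    have "s - cmod a \<le> cmod (z - a)" using False norm_triangle_ineq2[of z a] by simp
    moreover have "z \<noteq> a" using False s by auto
    ultimately have "cmod (h' z) \<le> K / (s - cmod a)"
      using s K[OF z] order_trans[OF norm_ge_zero K[OF z]]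
      by (auto simp: h'_def norm_divide intro!: frac_le)
    then show ?thesis by simp
  qed (use K' in fastforce)
  with hol have "h' \<in> H_inf" unfolding H_inf_iff_bound by blast
  moreover have "h z = (z - a) * h' z" for z using a by (simp add: h'_def)
  ultimately show ?thesis by (rule that)
qed

text \<open>
Among the polynomials that can be split off from \<open>g\<close>, one of maximal degree leaves a
cofactor without zeros, since any zero could be split off as a further linear factor.  If \<open>g\<close>
vanishes on the disc, the hypothesis \<open>bound\<close> fails: every polynomial with roots in the disc can be split off with cofactor \<open>0\<close>.
\<close>

lemma H_inf_factor_zeros:
  assumes g: "g \<in> H_inf"
    and bound: "\<And>b h. \<lbrakk>b \<noteq> 0; \<And>z. poly b z = 0 \<Longrightarrow> cmod z < 1; h \<in> H_inf;
                  \<And>z. cmod z < 1 \<Longrightarrow> g z = poly b z * h z\<rbrakk> \<Longrightarrow> degree b \<le> N"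
  obtains b h where "b \<noteq> 0" "\<And>z. poly b z = 0 \<Longrightarrow> cmod z < 1" "degree b \<le> N" "h \<in> H_inf"
    "\<And>z. cmod z < 1 \<Longrightarrow> g z = poly b z * h z" "\<And>z. cmod z < 1 \<Longrightarrow> h z \<noteq> 0"
proof -
  define Q where "Q b \<longleftrightarrow> b \<noteq> 0 \<and> (\<forall>z. poly b z = 0 \<longrightarrow> cmod z < 1) \<and>
      (\<exists>h\<in>H_inf. \<forall>z. cmod z < 1 \<longrightarrow> g z = poly b z * h z)" for b
  have Q_le: "degree b \<le> N" if "Q b" for b
    using that bound unfolding Q_def by blast
  have "Q 1" using g by (auto simp: Q_def)
  then obtain b where b: "Q b" and max: "\<And>c. Q c \<Longrightarrow> degree c \<le> degree b"
    using ex_has_greatest_nat[of Q 1 degree "Suc N"] Q_le by (metis le_imp_less_Suc)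
  obtain h where h: "h \<in> H_inf" "\<And>z. cmod z < 1 \<Longrightarrow> g z = poly b z * h z"
    using b unfolding Q_def by blast
  have "h a \<noteq> 0" if a: "cmod a < 1" for a
  proof
    assume "h a = 0"
    then obtain h' where h': "h' \<in> H_inf" "\<And>z. h z = (z - a) * h' z"
      using H_inf_divide_zero[OF h(1) a] by metis
    have "Q ([:-a, 1:] * b)"
      unfolding Q_def
    proof (intro conjI bexI[OF _ h'(1)])
      show "\<forall>z. cmod z < 1 \<longrightarrow> g z = poly ([:- a, 1:] * b) z * h' z"
        using h(2) h'(2) by (simp add: algebra_simps)
      show "[:- a, 1:] * b \<noteq> 0" using b by (simp only: Q_def mult_eq_0_iff) simp
      show "\<forall>z. poly ([:- a, 1:] * b) z = 0 \<longrightarrow> cmod z < 1"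
        using b a unfolding poly_mult by (auto simp: Q_def)
    qed
    then have "degree ([:-a, 1:] * b) \<le> degree b" by (rule max)
    then show False using b unfolding Q_def by (subst (asm) degree_mult_eq) auto
  qed
  then show ?thesis using that[of b h] b h Q_le unfolding Q_def by blast
qed

lemma zorder_poly_times_nonzero:
  assumes b: "b \<noteq> 0" and s: "open S" "z \<in> S" and h: "h holomorphic_on S" "h z \<noteq> 0"
    and f: "\<And>x. x \<in> S \<Longrightarrow> f x = poly b x * h x"
  shows "zorder f z = int (order z b)"
proof -
  obtain q where q: "b = [:- z, 1:] ^ order z b * q" "\<not> [:- z, 1:] dvd q"
    using order_decomp[OF b] by blast
  have qz: "poly q z \<noteq> 0" using q(2) by (simp add: poly_eq_0_iff_dvd)
  show ?thesis
  proof (rule zorder_eqI[OF s])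
    show "(\<lambda>x. poly q x * h x) holomorphic_on S" by (intro holomorphic_intros h)
    show "poly q z * h z \<noteq> 0" using qz h by simp
    fix x assume x: "x \<in> S" "x \<noteq> z"
    have "poly b x = (x - z) ^ order z b * poly q x"
      by (subst q(1)) (simp add: poly_power)
    then show "f x = poly q x * h x * (x - z) powi int (order z b)"
      using f[OF x(1)] by simp
  qed
qed

text \<open>
Off the roots of \<open>B\<close>, the function \<open>f - w\<close> is \<open>b\<close> times the zero-free analytic function \<open>h / B\<close>, so its
zeros are roots of \<open>b\<close> of the same order; the orders of all roots of \<open>b\<close> add up to at most its degree.
\<close>

lemma zero_count_quotient_le:
  assumes B: "B \<noteq> 0" and b: "b \<noteq> 0" "degree b \<le> N" and h: "h holomorphic_on ball 0 1"
    "\<And>z. cmod z < 1 \<Longrightarrow> h z \<noteq> 0"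
    and eq: "\<And>z. cmod z < 1 \<Longrightarrow> poly B z \<noteq> 0 \<Longrightarrow> poly B z * (f z - w) = poly b z * h z"
    and pole: "\<And>z. cmod z < 1 \<Longrightarrow> poly B z = 0 \<Longrightarrow> is_pole f z"
  shows "finite {z \<in> ball 0 1. \<not> is_pole f z \<and> f z = w} \<and>
     (\<Sum>z\<in>{z \<in> ball 0 1. \<not> is_pole f z \<and> f z = w}. zorder (\<lambda>z. f z - w) z) \<le> int N"
proof -
  let ?S = "{z \<in> ball 0 1. \<not> is_pole f z \<and> f z = w}"
  have nz: "poly B z \<noteq> 0" if "z \<in> ?S" for z using that pole by auto
  have sub: "?S \<subseteq> {z. poly b z = 0}"
    using nz eq h by force
  have fin: "finite {z. poly b z = 0}" using b by (intro poly_roots_finite)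
  have ord: "zorder (\<lambda>z. f z - w) z = int (order z b)" if z: "z \<in> ?S" for z
  proof (rule zorder_poly_times_nonzero[OF b(1)])
    let ?D = "ball 0 1 - {z. poly B z = 0}"
    show "open ?D" using B by (intro open_Diff finite_imp_closed poly_roots_finite) auto
    show "z \<in> ?D" using nz z by auto
    show "(\<lambda>x. h x / poly B x) holomorphic_on ?D"
      by (intro holomorphic_intros holomorphic_on_subset[OF h(1)]) auto
    show "h z / poly B z \<noteq> 0" using h z nz by auto
    show "f x - w = poly b x * (h x / poly B x)" if "x \<in> ?D" for x
      using eq[of x] that by (simp add: field_simps)
  qed
  have "(\<Sum>z\<in>?S. zorder (\<lambda>z. f z - w) z) = (\<Sum>z\<in>?S. int (order z b))"
    by (intro sum.cong ord refl)
  also have "\<dots> \<le> (\<Sum>z\<in>{z. poly b z = 0}. int (order z b))"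
    by (intro sum_mono2 fin sub) auto
  also have "\<dots> = int (\<Sum>z | poly b z = 0. order z b)" by simp
  also have "\<dots> \<le> int N"
    using sum_order_le_degree[OF b(1)] b(2) by linarith
  finally show ?thesis using finite_subset[OF sub fin] by simp
qed

section \<open>The symbol as a quotient\<close>

context
  fixes P :: "complex poly" and r :: nat and k :: "nat \<Rightarrow> nat"
    and \<eta> :: "nat \<Rightarrow> complex" and \<alpha> :: "nat \<Rightarrow> nat \<Rightarrow> complex"
begin

definition pole_factor :: "nat \<Rightarrow> complex poly" where
  "pole_factor l = [:1, - \<eta> l:] ^ k l"

definition symbol_denom :: "complex poly" where
  "symbol_denom = monom 1 (degree P) * (\<Prod>l=1..r. pole_factor l)"

text \<open>
The polynomial obtained from \<open>R(1/z)\<close> by clearing denominators with \<open>symbol_denom\<close>.  Each summand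
\<open>\<alpha> / (1/z - \<eta>\<^sub>l) ^ j\<close> equals \<open>\<alpha> * z ^ j / (1 - \<eta>\<^sub>l z) ^ j\<close>.
\<close>

definition symbol_num :: "complex poly" where
  "symbol_num = reflect_poly P * (\<Prod>l=1..r. pole_factor l) +
     monom 1 (degree P) * (\<Sum>l=1..r. \<Sum>j=1..k l.
        smult (\<alpha> l j) (monom 1 j * [:1, - \<eta> l:] ^ (k l - j) * (\<Prod>i\<in>{1..r}-{l}. pole_factor i)))"

lemma poly_pole_factor: "poly (pole_factor l) z = (1 - \<eta> l * z) ^ k l"
  by (simp add: pole_factor_def poly_power mult.commute)

lemma poly_symbol_num:
  "poly symbol_num z = poly (reflect_poly P) z * (\<Prod>l=1..r. (1 - \<eta> l * z) ^ k l) +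
     z ^ degree P * (\<Sum>l=1..r. \<Sum>j=1..k l.
        \<alpha> l j * (z ^ j * (1 - \<eta> l * z) ^ (k l - j) * (\<Prod>i\<in>{1..r}-{l}. (1 - \<eta> i * z) ^ k i)))"
  by (simp add: symbol_num_def poly_prod poly_sum poly_monom poly_power poly_pole_factor mult.commute[of z])

lemma poly_symbol_denom:
  "poly symbol_denom z = z ^ degree P * (\<Prod>l=1..r. (1 - \<eta> l * z) ^ k l)"
  by (simp add: symbol_denom_def poly_prod poly_monom poly_pole_factor)

text \<open>
The point \<open>0\<close> needs separate treatment.  It is not a root of the denominator only if \<open>P\<close> is
constant, and then every principal part at an \<open>\<eta>\<^sub>l\<close> contributes a positive power of \<open>z\<close>, which vanishes.
\<close>

lemma symbol_fun_eq_num_denom: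
  assumes nz: "poly symbol_denom z \<noteq> 0"
  shows "poly symbol_denom z * (symbol_fun P r k \<eta> \<alpha> \<phi> z - \<phi> z) = poly symbol_num z"
proof (cases "z = 0")
  case True
  have "degree P = 0" using nz True by (auto simp: poly_symbol_denom zero_power)
  then have P: "P = [:coeff P 0:]" by (metis degree_eq_zeroE coeff_pCons_0)
  have "poly (reflect_poly P) 0 = coeff P 0" using \<open>degree P = 0\<close> by simp
  moreover have "(\<Sum>l=1..r. \<Sum>j=1..k l. \<alpha> l j * (0 ^ j * (1 - \<eta> l * 0) ^ (k l - j) * (\<Prod>i\<in>{1..r}-{l}. (1 - \<eta> i * 0) ^ k i))) = 0"
    by (intro sum.neutral ballI) auto
  ultimately show ?thesis
    using True \<open>degree P = 0\<close> unfolding poly_symbol_num poly_symbol_denom symbol_fun_def by simp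
next
  case False
  have ne: "1 - \<eta> l * z \<noteq> 0 \<or> k l = 0" if "l \<in> {1..r}" for l
    using nz that by (auto simp: poly_symbol_denom)
  have "(\<Prod>i=1..r. (1 - \<eta> i * z) ^ k i) * (\<alpha> l j / (1 / z - \<eta> l) ^ j)
      = \<alpha> l j * (z ^ j * (1 - \<eta> l * z) ^ (k l - j) * (\<Prod>i\<in>{1..r}-{l}. (1 - \<eta> i * z) ^ k i))"
    if l: "l \<in> {1..r}" and j: "j \<in> {1..k l}" for l j
  proof -
    have ne': "1 - \<eta> l * z \<noteq> 0" using ne[OF l] j by auto
    have "1 / z - \<eta> l = (1 - \<eta> l * z) / z" using False by (simp add: field_simps)
    then have 1: "\<alpha> l j / (1 / z - \<eta> l) ^ j = \<alpha> l j * z ^ j / (1 - \<eta> l * z) ^ j"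
      by (simp add: power_divide)
    have 2: "(\<Prod>i=1..r. (1 - \<eta> i * z) ^ k i) = (1 - \<eta> l * z) ^ k l * (\<Prod>i\<in>{1..r}-{l}. (1 - \<eta> i * z) ^ k i)"
      using l by (intro prod.remove) auto
    have 3: "(1 - \<eta> l * z) ^ k l = (1 - \<eta> l * z) ^ (k l - j) * (1 - \<eta> l * z) ^ j"
      using j by (simp flip: power_add)
    show ?thesis unfolding 1 2 3 using ne' by (simp add: field_simps)
  qed
  then have "(\<Prod>i=1..r. (1 - \<eta> i * z) ^ k i) * (\<Sum>l=1..r. \<Sum>j=1..k l. \<alpha> l j / (1 / z - \<eta> l) ^ j)
     = (\<Sum>l=1..r. \<Sum>j=1..k l. \<alpha> l j * (z ^ j * (1 - \<eta> l * z) ^ (k l - j) * (\<Prod>i\<in>{1..r}-{l}. (1 - \<eta> i * z) ^ k i)))"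
    unfolding sum_distrib_left by (intro sum.cong refl) 
  moreover have "poly (reflect_poly P) z = z ^ degree P * poly P (1 / z)"
    using False by (simp add: poly_reflect_poly_nz inverse_eq_divide)
  ultimately show ?thesis
    unfolding poly_symbol_num poly_symbol_denom symbol_fun_def rational_pf_def
    using False by (simp only: if_False) (simp add: algebra_simps)
qed

lemma pole_factor_nonzero: "pole_factor l \<noteq> 0"
  by (simp add: pole_factor_def)

lemma symbol_denom_nonzero: "symbol_denom \<noteq> 0"
  using pole_factor_nonzero by (simp add: symbol_denom_def)

lemma degree_symbol_denom:
  assumes "\<And>l. l \<in> {1..r} \<Longrightarrow> \<eta> l \<noteq> 0"
  shows "degree symbol_denom = degree P + (\<Sum>l=1..r. k l)"
proof -
  have "degree (\<Prod>l=1..r. pole_factor l) = (\<Sum>l=1..r. degree (pole_factor l))"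
    using pole_factor_nonzero by (intro degree_prod_eq_sum_degree) auto
  also have "\<dots> = (\<Sum>l=1..r. k l)"
    using assms by (intro sum.cong refl) (simp add: pole_factor_def degree_power_eq)
  finally show ?thesis
    using pole_factor_nonzero unfolding symbol_denom_def
    by (subst degree_mult_eq) (auto simp: degree_monom_eq)
qed

lemma symbol_denom_roots:
  assumes out: "\<And>l. l \<in> {1..r} \<Longrightarrow> 1 < cmod (\<eta> l)"
    and "poly symbol_denom z = 0"
  shows "cmod z < 1"
proof -
  consider "z = 0" | l where "l \<in> {1..r}" "\<eta> l * z = 1"
    using assms(2) by (auto simp: poly_symbol_denom)
  then show ?thesis
  proof cases
    case 2
    then have "cmod (\<eta> l) * cmod z = 1" by (metis norm_mult norm_one)
    moreover have "1 < cmod (\<eta> l)" using out[OF 2(1)] .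
    ultimately show ?thesis by (smt (verit) mult_le_cancel_left1 norm_ge_zero)
  qed simp
qed

text \<open>
The quotient is in lowest terms.  At \<open>1 / \<eta>\<^sub>l\<close> the only surviving summand is the one with the top
coefficient \<open>\<alpha>\<^sub>l\<close> of index \<open>j = k\<^sub>l\<close>; at \<open>0\<close>, a root of the denominator only if \<open>P\<close> is not constant,
the value is the leading coefficient of \<open>P\<close>.
\<close>

lemma symbol_num_nonzero_at_pole:
  assumes inj: "inj_on \<eta> {1..r}"
    and top: "\<And>l. l \<in> {1..r} \<Longrightarrow> k l \<ge> 1 \<and> \<alpha> l (k l) \<noteq> 0"
    and z: "poly symbol_denom z = 0"
  shows "poly symbol_num z \<noteq> 0"
proof (cases "\<exists>l\<in>{1..r}. \<eta> l * z = 1")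
  case True
  then obtain l where l: "l \<in> {1..r}" "\<eta> l * z = 1" by blast
  then have "z \<noteq> 0" by auto
  have other: "1 - \<eta> i * z \<noteq> 0" if "i \<in> {1..r} - {l}" for i
  proof
    assume "1 - \<eta> i * z = 0"
    then have "\<eta> i * z = \<eta> l * z" using l by simp
    then have "\<eta> i = \<eta> l" using \<open>z \<noteq> 0\<close> by simp
    then show False using inj that l by (auto dest: inj_onD)
  qed
  have kl: "k l \<ge> 1" "\<alpha> l (k l) \<noteq> 0" using top[OF l(1)] by auto
  have zero: "(1 - \<eta> l * z) ^ k l = 0" using l kl by simp
  let ?t = "\<lambda>i j. \<alpha> i j * (z ^ j * (1 - \<eta> i * z) ^ (k i - j) * (\<Prod>i\<in>{1..r}-{i}. (1 - \<eta> i * z) ^ k i))"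
  have prod0: "(\<Prod>i\<in>A. (1 - \<eta> i * z) ^ k i) = 0" if "l \<in> A" "finite A" for A
    using that zero by (intro prod_zero) auto
  have "(\<Sum>i=1..r. \<Sum>j=1..k i. ?t i j) = (\<Sum>i\<in>{l}. \<Sum>j=1..k i. ?t i j)"
    using l by (intro sum.mono_neutral_right) (auto simp: prod0)
  also have "\<dots> = (\<Sum>j=1..k l. ?t l j)" by simp
  also have "\<dots> = (\<Sum>j\<in>{k l}. ?t l j)"
    using l kl by (intro sum.mono_neutral_right) auto
  also have "\<dots> = \<alpha> l (k l) * (z ^ k l * (\<Prod>i\<in>{1..r}-{l}. (1 - \<eta> i * z) ^ k i))"
    by simp
  also have "\<dots> \<noteq> 0" using kl other \<open>z \<noteq> 0\<close> by auto
  finally have "(\<Sum>i=1..r. \<Sum>j=1..k i. ?t i j) \<noteq> 0" .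
  moreover have "poly symbol_num z = z ^ degree P * (\<Sum>i=1..r. \<Sum>j=1..k i. ?t i j)"
    unfolding poly_symbol_num prod0[OF l(1) finite_atLeastAtMost] by simp
  ultimately show ?thesis
    using \<open>z \<noteq> 0\<close> by simp
next
  case False
  then have "z ^ degree P = 0" using z by (auto simp: poly_symbol_denom)
  then have "z = 0" "degree P > 0" by (auto intro: Nat.gr0I)
  then show ?thesis unfolding poly_symbol_num by auto
qed

text \<open>
This excludes the roots of the denominator from the solutions that are counted.
\<close>

lemma symbol_fun_pole:
  assumes out: "\<And>l. l \<in> {1..r} \<Longrightarrow> 1 < cmod (\<eta> l)"
    and inj: "inj_on \<eta> {1..r}"
    and top: "\<And>l. l \<in> {1..r} \<Longrightarrow> k l \<ge> 1 \<and> \<alpha> l (k l) \<noteq> 0"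
    and z: "poly symbol_denom z = 0" and \<phi>: "\<phi> holomorphic_on ball 0 1"
  shows "is_pole (symbol_fun P r k \<eta> \<alpha> \<phi>) z"
proof -
  let ?C = "\<lambda>x. poly symbol_num x + poly symbol_denom x * \<phi> x"
  have "isCont \<phi> z"
    using symbol_denom_roots[OF out z] \<phi>
    by (intro continuous_on_interior[OF holomorphic_on_imp_continuous_on[OF \<phi>]]) simp
  then have "isCont ?C z" by (intro continuous_intros)
  then have "(?C \<longlongrightarrow> poly symbol_num z) (at z)" using z by (simp add: isCont_def)
  have "finite {x. poly symbol_denom x = 0}"
    using symbol_denom_nonzero by (rule poly_roots_finite)
  then have ev: "\<forall>\<^sub>F x in at z. poly symbol_denom x \<noteq> 0"
    using islimpt_finite[of "{x. poly symbol_denom x = 0}" z] by (simp add: islimpt_iff_eventually)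
  have "isCont (poly symbol_denom) z" by (intro continuous_intros)
  then have "filterlim (poly symbol_denom) (at 0) (at z)"
    using z ev by (simp add: filterlim_at isCont_def)
  then have "filterlim (\<lambda>x. ?C x / poly symbol_denom x) at_infinity (at z)"
    using \<open>(?C \<longlongrightarrow> _) _\<close> symbol_num_nonzero_at_pole[OF inj top z] by (intro filterlim_divide_at_infinity)
  moreover have "\<forall>\<^sub>F x in at z. ?C x / poly symbol_denom x = symbol_fun P r k \<eta> \<alpha> \<phi> x"
    using ev
  proof eventually_elim
    case (elim x)
    then show ?case using symbol_fun_eq_num_denom[OF elim, of \<phi>, symmetric]
      by (simp add: field_simps)
  qed
  ultimately show ?thesis
    unfolding is_pole_def by (rule filterlim_cong[OF refl refl, THEN iffD1, rotated])
qed

end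

section \<open>The valence of the symbol\<close>

theorem proposition1p1:
  fixes P :: "complex poly"
    and r :: nat
    and k :: "nat \<Rightarrow> nat"
    and \<eta> :: "nat \<Rightarrow> complex"
    and \<alpha> :: "nat \<Rightarrow> nat \<Rightarrow> complex"
    and \<phi> \<psi> \<Phi> :: "complex \<Rightarrow> complex"
    and N\<^sub>1 N\<^sub>2 N :: nat
    and T :: "(complex \<Rightarrow> complex) \<Rightarrow> (complex \<Rightarrow> complex)"
  assumes "\<Phi> = symbol_fun P r k \<eta> \<alpha> \<phi>"
    and "N\<^sub>1 = degree P"
    and "N\<^sub>2 = (\<Sum>l=1..r. k l)"
    and "N = N\<^sub>1 + N\<^sub>2"
    and "inj_on \<eta> {1..r}"
    and "\<And>l. l \<in> {1..r} \<Longrightarrow> \<eta> l \<notin> cball 0 1"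
    and "\<And>l. l \<in> {1..r} \<Longrightarrow> k l \<ge> 1 \<and> \<alpha> l (k l) \<noteq> 0"
    and "\<phi> \<in> H_inf"
    and "boundary_function \<Phi> \<psi>"
    and "toeplitz_operator \<psi> T"
    and "hypercyclic_on_H2 T"
  shows "valent_in_disc N \<Phi>"
proof -
  let ?B = "symbol_denom P r k \<eta>"
  have out: "1 < cmod (\<eta> l)" if "l \<in> {1..r}" for l
    using assms(6)[OF that] by simp
  have B: "?B \<noteq> 0" "\<And>z. poly ?B z = 0 \<Longrightarrow> cmod z < 1"
    by (rule symbol_denom_nonzero) (rule symbol_denom_roots[where \<eta> = \<eta> and r = r, OF out])
  have deg: "degree ?B = N"
    using degree_symbol_denom[where \<eta> = \<eta> and r = r and P = P and k = k] out assms(2-4) by force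
  show ?thesis
    unfolding valent_in_disc_def Let_def
  proof
    fix w
    define g where "g z = poly (symbol_num P r k \<eta> \<alpha>) z + poly ?B z * (\<phi> z + poly [:- w:] z)" for z
    have g: "g \<in> H_inf"
      unfolding g_def by (intro H_inf_add H_inf_mult H_inf_poly assms)
    have g_eq: "poly ?B z * (\<Phi> z - w) = g z" if "poly ?B z \<noteq> 0" for z
      unfolding g_def symbol_fun_eq_num_denom[OF that, of \<alpha> \<phi>, symmetric] assms(1)
      by (simp add: algebra_simps)
    obtain b h where bh: "b \<noteq> 0" "degree b \<le> N" "h \<in> H_inf"
        "\<And>z. cmod z < 1 \<Longrightarrow> g z = poly b z * h z" "\<And>z. cmod z < 1 \<Longrightarrow> h z \<noteq> 0"
    proof (rule H_inf_factor_zeros[OF g])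
      fix b h
      assume "b \<noteq> 0" "\<And>z. poly b z = 0 \<Longrightarrow> cmod z < 1" "h \<in> H_inf"
        "\<And>z. cmod z < 1 \<Longrightarrow> g z = poly b z * h z"
      then show "degree b \<le> N"
        using toeplitz_hypercyclic_zero_bound[OF assms(9-11), of b ?B h w] B g_eq deg by simp
    qed blast
    show "finite {z \<in> ball 0 1. \<not> is_pole \<Phi> z \<and> \<Phi> z = w} \<and>
      (\<Sum>z\<in>{z \<in> ball 0 1. \<not> is_pole \<Phi> z \<and> \<Phi> z = w}. zorder (\<lambda>z. \<Phi> z - w) z) \<le> int N"
    proof (rule zero_count_quotient_le[OF B(1) bh(1,2)])
      show "h holomorphic_on ball 0 1" using bh by (simp add: H_inf_def)
      show "is_pole \<Phi> z" if "poly ?B z = 0" for z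
        unfolding assms(1) using symbol_fun_pole[where \<alpha> = \<alpha> and k = k, OF out assms(5) assms(7) that] assms(8)
        by (simp add: H_inf_def)
    qed (use bh g_eq in auto)
  qed
qed

end
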